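(* Let $\mathbb{K}$ be an algebraically closed field of characteristic zero. The affine group $\mathrm{Aff}_2(\mathbb{K})$ is a maximal closed subgroup of the plane polynomial automorphism group $\mathrm{GA}_2(\mathbb{K})$ for the inductive limit topology; that is, $\mathrm{Aff}_2(\mathbb{K})$ is a proper closed subgroup of $\mathrm{GA}_2(\mathbb{K})$, and every closed subgroup of $\mathrm{GA}_2(\mathbb{K})$ strictly containing $\mathrm{Aff}_2(\mathbb{K})$ is equal to $\mathrm{GA}_2(\mathbb{K})$.
   Context: Let $\mathcal{E}=\mathrm{End}_2(\mathbb{K})$ be the set $(\mathbb{K}[x_1,x_2])^2$ endowed with the composition law $\sigma\tau=(f_1(g_1,g_2),f_2(g_1,g_2))$ for $\sigma=(f_1,f_2)$ and $\tau=(g_1,g_2)$; it is a monoid with identity $(x_1,x_2)$. Let $\mathrm{GA}_2(\mathbb{K})$ be the group of invertible elements of $\mathcal{E}$. The degree of $\sigma=(f_1,f_2)$ is $\deg(\sigma)=\max(\deg f_1,\deg f_2)$, and $\mathrm{Aff}_2(\mathbb{K})=\{\sigma\in\mathrm{GA}_2(\mathbb{K}) : \deg(\sigma)=1\}$. Topology: for each positive integer $d$, the set $\mathcal{E}_{\le d}$ of elements of $\mathcal{E}$ of degree $\le d$ is a finite-dimensional $\mathbb{K}$-vector space, regarded as an affine space and endowed with the Zariski topology; $\mathcal{E}_{\le d}$ is closed in $\mathcal{E}_{\le d+1}$. The set $\mathcal{E}=\bigcup_{d\ge 1}\mathcal{E}_{\le d}$ carries the inductive limit topology: $A\subset\mathcal{E}$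 is closed if and only if $A\cap\mathcal{E}_{\le d}$ is closed in $\mathcal{E}_{\le d}$ for every $d\ge 1$. The group $\mathrm{GA}_2(\mathbb{K})$ carries the subspace topology induced from $\mathcal{E}$. *)

theory Defs
  imports
    "HOL-Computational_Algebra.Polynomial"
    "HOL-Analysis.Abstract_Topology"
    "HOL-Algebra.Group"
begin

text \<open>
  The ring \<open>K[x\<^sub>1, x\<^sub>2]\<close> is rendered as \<open>K[x\<^sub>1][x\<^sub>2]\<close>: the inner variable of an \<open>'a poly poly\<close>
  is \<open>x\<^sub>1\<close>, the outer one is \<open>x\<^sub>2\<close>.
\<close>

type_synonym 'a poly2 = "'a poly poly"

definition X1 :: "'a::comm_ring_1 poly2" where
  "X1 = [:[:0, 1:]:]"

definition X2 :: "'a::comm_ring_1 poly2" where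
  "X2 = [:0, 1:]"

text \<open>The coefficient of \<open>x\<^sub>1\<^sup>i x\<^sub>2\<^sup>j\<close>.\<close>

definition coeff2 :: "'a::zero poly2 \<Rightarrow> nat \<Rightarrow> nat \<Rightarrow> 'a" where
  "coeff2 p i j = coeff (coeff p j) i"

text \<open>
  Total degree, with the convention that the zero polynomial has degree 0. Only the conditions
  \<open>degree \<le> d\<close> for \<open>d \<ge> 1\<close> and \<open>degree = 1\<close> are used below, and for these it is
  immaterial whether the degree of 0 is 0 or minus infinity.
\<close>

definition degree2 :: "'a::zero poly2 \<Rightarrow> nat" where
  "degree2 p = Max (insert 0 {i + j | i j. coeff2 p i j \<noteq> 0})"

text \<open>Substitution \<open>f(g\<^sub>1, g\<^sub>2)\<close>; scalars are embedded as \<open>[:[:a:]:]\<close>.\<close>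

definition subst2 :: "'a::comm_ring_1 poly2 \<Rightarrow> 'a poly2 \<Rightarrow> 'a poly2 \<Rightarrow> 'a poly2" where
  "subst2 f g1 g2 = poly (map_poly (\<lambda>c. poly (map_poly (\<lambda>a. [:[:a:]:]) c) g1) f) g2"

lemma finite_coeff2_support: "finite {(i, j). coeff2 p i j \<noteq> 0}"
proof (rule finite_subset)
  show "{(i, j). coeff2 p i j \<noteq> 0} \<subseteq> (\<Union>j\<le>degree p. {..degree (coeff p j)} \<times> {j})"
  proof clarify
    fix i j assume "coeff2 p i j \<noteq> 0"
    then have "i \<le> degree (coeff p j)" "coeff p j \<noteq> 0"
      by (auto simp: coeff2_def intro: le_degree)
    then show "(i, j) \<in> (\<Union>j\<le>degree p. {..degree (coeff p j)} \<times> {j})"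
      by (auto intro: le_degree)
  qed
qed auto

lemma degree2_le_iff: "degree2 p \<le> d \<longleftrightarrow> (\<forall>i j. coeff2 p i j \<noteq> 0 \<longrightarrow> i + j \<le> d)"
proof -
  have "{i + j | i j. coeff2 p i j \<noteq> 0} = (\<lambda>(i, j). i + j) ` {(i, j). coeff2 p i j \<noteq> 0}"
    by auto
  then have "finite {i + j | i j. coeff2 p i j \<noteq> 0}"
    using finite_coeff2_support[of p] by simp
  then show ?thesis
    by (auto simp: degree2_def)
qed

lemma poly_map_poly_add:
  fixes h :: "'a::comm_ring_1 \<Rightarrow> 'b::comm_ring_1"
  assumes "h 0 = 0" "\<And>a b. h (a + b) = h a + h b"
  shows "poly (map_poly h (p + q)) x = poly (map_poly h p) x + poly (map_poly h q) x"
proof -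
  have "map_poly h (p + q) = map_poly h p + map_poly h q"
    by (intro poly_eqI) (simp add: coeff_map_poly assms)
  then show ?thesis by simp
qed

lemma poly_map_poly_mult:
  fixes h :: "'a::comm_ring_1 \<Rightarrow> 'b::comm_ring_1"
  assumes "h 0 = 0" "\<And>a b. h (a + b) = h a + h b" "\<And>a b. h (a * b) = h a * h b"
  shows "poly (map_poly h (p * q)) x = poly (map_poly h p) x * poly (map_poly h q) x"
proof (induction p)
  case (pCons a p)
  have "poly (map_poly h (smult a q)) x = h a * poly (map_poly h q) x"
    by (subst map_poly_smult) (simp_all add: assms)
  with pCons show ?case
    by (simp add: poly_map_poly_add assms map_poly_pCons algebra_simps)
qed simp

lemma subst2_0 [simp]: "subst2 0 g1 g2 = 0"
  by (simp add: subst2_def)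

lemma subst2_const: "subst2 [:[:a:]:] g1 g2 = [:[:a:]:]"
  by (simp add: subst2_def map_poly_pCons)

lemma subst2_X1 [simp]: "subst2 X1 g1 g2 = g1"
  by (simp add: subst2_def X1_def map_poly_pCons flip: one_pCons)

lemma subst2_X2 [simp]: "subst2 X2 g1 g2 = g2"
  by (simp add: subst2_def X2_def map_poly_pCons map_poly_1' flip: one_pCons)

lemma subst2_add: "subst2 (p + q) g1 g2 = subst2 p g1 g2 + subst2 q g1 g2"
  unfolding subst2_def by (intro poly_map_poly_add) (auto simp: poly_map_poly_add)

lemma subst2_mult: "subst2 (p * q) g1 g2 = subst2 p g1 g2 * subst2 q g1 g2"
  unfolding subst2_def
  by (intro poly_map_poly_mult) (auto simp: poly_map_poly_add poly_map_poly_mult)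

lemma poly2_induct [case_names const X1 X2 add mult]:
  fixes p :: "'a::comm_ring_1 poly2"
  assumes const: "\<And>a. P [:[:a:]:]" and X1: "P X1" and X2: "P X2"
    and add: "\<And>p q. P p \<Longrightarrow> P q \<Longrightarrow> P (p + q)"
    and mult: "\<And>p q. P p \<Longrightarrow> P q \<Longrightarrow> P (p * q)"
  shows "P p"
proof -
  have inner: "P [:c:]" for c
  proof (induction c)
    case 0
    show ?case using const[of 0] by simp
  next
    case (pCons a c)
    have "[:pCons a c:] = [:[:a:]:] + X1 * [:c:]"
      by (simp add: X1_def)
    then show ?case using const X1 add mult pCons by metis
  qed
  show ?thesis
  proof (induction p)
    case 0
    show ?case using const[of 0] by simp
  next
    case (pCons c p)
    have "pCons c p = [:c:] + X2 * p"
      by (simp add: X2_def)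
    then show ?case using inner X2 add mult pCons by metis
  qed
qed

lemma subst2_ident [simp]: "subst2 p X1 X2 = p"
  by (induction p rule: poly2_induct) (simp_all add: subst2_const subst2_add subst2_mult)

lemma subst2_subst2:
  "subst2 (subst2 f g1 g2) k1 k2 = subst2 f (subst2 g1 k1 k2) (subst2 g2 k1 k2)"
  by (induction f rule: poly2_induct) (simp_all add: subst2_const subst2_add subst2_mult)

type_synonym 'a end2 = "'a poly2 \<times> 'a poly2"

definition comp2 :: "'a::comm_ring_1 end2 \<Rightarrow> 'a end2 \<Rightarrow> 'a end2" where
  "comp2 \<sigma> \<tau> = (subst2 (fst \<sigma>) (fst \<tau>) (snd \<tau>), subst2 (snd \<sigma>) (fst \<tau>) (snd \<tau>))"

definition End2 :: "'a::comm_ring_1 end2 monoid" where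
  "End2 = \<lparr>carrier = UNIV, mult = comp2, one = (X1, X2)\<rparr>"

definition GA2 :: "'a::comm_ring_1 end2 monoid" where
  "GA2 = units_of End2"

definition deg_end2 :: "'a::zero end2 \<Rightarrow> nat" where
  "deg_end2 \<sigma> = max (degree2 (fst \<sigma>)) (degree2 (snd \<sigma>))"

definition Aff2 :: "'a::comm_ring_1 end2 set" where
  "Aff2 = {\<sigma> \<in> carrier GA2. deg_end2 \<sigma> = 1}"

lemma monoid_End2: "monoid End2"
  by (rule monoidI) (auto simp: End2_def comp2_def subst2_subst2)

lemma group_GA2: "group GA2"
  unfolding GA2_def using monoid_End2 by (rule monoid.units_group)

definition End2_le :: "nat \<Rightarrow> 'a::zero end2 set" where
  "End2_le d = {\<sigma>. deg_end2 \<sigma> \<le> d}"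

text \<open>
  The polynomial functions on the affine space \<open>End2_le d\<close>, whose coordinates are the
  coefficients of the monomials of total degree at most \<open>d\<close> in the two components.
\<close>

inductive_set polyfun_End2 :: "nat \<Rightarrow> ('a::comm_ring_1 end2 \<Rightarrow> 'a) set" for d where
  coord1: "i + j \<le> d \<Longrightarrow> (\<lambda>\<sigma>. coeff2 (fst \<sigma>) i j) \<in> polyfun_End2 d"
| coord2: "i + j \<le> d \<Longrightarrow> (\<lambda>\<sigma>. coeff2 (snd \<sigma>) i j) \<in> polyfun_End2 d"
| const: "(\<lambda>\<sigma>. c) \<in> polyfun_End2 d"
| add: "p \<in> polyfun_End2 d \<Longrightarrow> q \<in> polyfun_End2 d \<Longrightarrow> (\<lambda>\<sigma>. p \<sigma> + q \<sigma>) \<in> polyfun_End2 d"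
| mult: "p \<in> polyfun_End2 d \<Longrightarrow> q \<in> polyfun_End2 d \<Longrightarrow> (\<lambda>\<sigma>. p \<sigma> * q \<sigma>) \<in> polyfun_End2 d"

definition zero_locus :: "nat \<Rightarrow> ('a::comm_ring_1 end2 \<Rightarrow> 'a) set \<Rightarrow> 'a end2 set" where
  "zero_locus d S = {\<sigma> \<in> End2_le d. \<forall>p\<in>S. p \<sigma> = 0}"

definition zariski_End2 :: "nat \<Rightarrow> 'a::idom end2 topology" where
  "zariski_End2 d =
     topology (\<lambda>U. \<exists>S \<subseteq> polyfun_End2 d. U = End2_le d - zero_locus d S)"

definition ind_topology :: "'a::idom end2 topology" where
  "ind_topology = topology (\<lambda>U. \<forall>d\<ge>1. openin (zariski_End2 d) (U \<inter> End2_le d))"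

definition GA2_topology :: "'a::idom end2 topology" where
  "GA2_topology = subtopology ind_topology (carrier GA2)"

lemma istopology_zariski_End2:
  "istopology (\<lambda>U :: 'a::idom end2 set. \<exists>S \<subseteq> polyfun_End2 d. U = End2_le d - zero_locus d S)"
  unfolding istopology_def
proof (intro conjI allI impI, goal_cases)
  case (1 U V)
  then obtain S T where S: "S \<subseteq> polyfun_End2 d" "U = End2_le d - zero_locus d S"
    and T: "T \<subseteq> polyfun_End2 d" "V = End2_le d - zero_locus d T"
    by blast
  define R where "R = {(\<lambda>\<sigma>. p \<sigma> * q \<sigma>) | p q. p \<in> S \<and> q \<in> T}"
  have "R \<subseteq> polyfun_End2 d"
    using S(1) T(1) by (auto simp: R_def intro: polyfun_End2.mult)
  moreover have "U \<inter> V = End2_le d - zero_locus d R"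
    unfolding S(2) T(2) zero_locus_def R_def by fastforce
  ultimately show ?case by blast
next
  case (2 \<U>)
  then obtain S where S: "\<And>U. U \<in> \<U> \<Longrightarrow> S U \<subseteq> polyfun_End2 d"
    "\<And>U. U \<in> \<U> \<Longrightarrow> U = End2_le d - zero_locus d (S U)"
    by metis
  have "\<Union>\<U> = (\<Union>U\<in>\<U>. End2_le d - zero_locus d (S U))"
    using S(2) by auto
  also have "\<dots> = End2_le d - zero_locus d (\<Union>U\<in>\<U>. S U)"
    by (auto simp: zero_locus_def)
  finally have "\<Union>\<U> = End2_le d - zero_locus d (\<Union>U\<in>\<U>. S U)" .
  moreover have "(\<Union>U\<in>\<U>. S U) \<subseteq> polyfun_End2 d"
    using S(1) by blast
  ultimately show ?case by blast
qed

lemma openin_zariski_End2: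
  "openin (zariski_End2 d) U \<longleftrightarrow> (\<exists>S \<subseteq> polyfun_End2 d. U = End2_le d - zero_locus d S)"
  unfolding zariski_End2_def topology_inverse'[OF istopology_zariski_End2] ..

lemma topspace_zariski_End2 [simp]: "topspace (zariski_End2 d) = End2_le d"
proof (rule antisym)
  show "topspace (zariski_End2 d) \<subseteq> End2_le d"
    unfolding topspace_def openin_zariski_End2 by blast
  have "End2_le d = End2_le d - zero_locus d {\<lambda>\<sigma>. 1}"
    by (auto simp: zero_locus_def)
  then have "openin (zariski_End2 d) (End2_le d)"
    unfolding openin_zariski_End2 using polyfun_End2.const by (metis empty_subsetI insert_subset)
  then show "End2_le d \<subseteq> topspace (zariski_End2 d)"
    by (rule openin_subset)
qed

lemma closedin_zariski_End2:
  "closedin (zariski_End2 d) A \<longleftrightarrow> (\<exists>S \<subseteq> polyfun_End2 d. A = zero_locus d S)"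
proof -
  have "zero_locus d S \<subseteq> End2_le d" for S :: "('a end2 \<Rightarrow> 'a) set"
    by (auto simp: zero_locus_def)
  then show ?thesis
    unfolding closedin_def openin_zariski_End2 topspace_zariski_End2
    by (metis Diff_subset double_diff order_refl)
qed

lemma istopology_ind_topology:
  "istopology (\<lambda>U :: 'a::idom end2 set. \<forall>d\<ge>1. openin (zariski_End2 d) (U \<inter> End2_le d))"
  unfolding istopology_def
proof (intro conjI allI impI, goal_cases)
  case (1 U V d)
  then have "openin (zariski_End2 d) ((U \<inter> End2_le d) \<inter> (V \<inter> End2_le d))"
    by blast
  moreover have "(U \<inter> End2_le d) \<inter> (V \<inter> End2_le d) = U \<inter> V \<inter> End2_le d"
    by blast
  ultimately show ?case by (simp only:)
next
  case (2 \<U> d)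
  then have "openin (zariski_End2 d) (\<Union>U\<in>\<U>. U \<inter> End2_le d)"
    by (intro openin_Union) auto
  then show ?case by simp
qed

lemma openin_ind_topology:
  "openin ind_topology U \<longleftrightarrow> (\<forall>d\<ge>1. openin (zariski_End2 d) (U \<inter> End2_le d))"
  unfolding ind_topology_def topology_inverse'[OF istopology_ind_topology] ..

lemma topspace_ind_topology [simp]: "topspace ind_topology = (UNIV :: 'a::idom end2 set)"
proof -
  have "openin (zariski_End2 d) (End2_le d :: 'a end2 set)" for d
    using openin_topspace[of "zariski_End2 d :: 'a end2 topology"] by simp
  then have "openin ind_topology (UNIV :: 'a end2 set)"
    by (simp add: openin_ind_topology)
  then show ?thesis
    using openin_subset by blast
qed

lemma closedin_ind_topology:
  "closedin ind_topology A \<longleftrightarrow> (\<forall>d\<ge>1. closedin (zariski_End2 d) (A \<inter> End2_le d))"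
proof -
  have "(UNIV - A) \<inter> End2_le d = End2_le d - A \<inter> End2_le d" for d
    by auto
  then show ?thesis
    by (simp add: closedin_def openin_ind_topology)
qed

end

theory Submission
  imports Defs
begin

text \<open>
  By the Jung--van der Kulk theorem it suffices that a closed subgroup \<open>H\<close> strictly containing
  the affine group contains every shear \<open>(x\<^sub>1 + p(x\<^sub>2), x\<^sub>2)\<close>.

  Modulo affine maps, \<open>H\<close> contains some \<open>\<sigma> \<noteq> id\<close> that agrees with the identity up to terms of
  order exactly \<open>d \<ge> 2\<close>. Conjugating with \<open>(t\<^sup>d x\<^sub>1, t x\<^sub>2)\<close> and letting \<open>t\<close> tend to 0
  gives \<open>(x\<^sub>1 + c x\<^sub>2\<^sup>d, x\<^sub>2) \<in> H\<close>, and \<open>c \<noteq> 0\<close> after a linear change of coordinates since \<open>\<sigma>\<close> has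
  constant Jacobian. The commutator of \<open>(x\<^sub>1 + x\<^sub>2\<^sup>d, x\<^sub>2)\<close> and \<open>(x\<^sub>1, x\<^sub>2 + x\<^sub>1\<^sup>d)\<close> is nontrivial and
  agrees with the identity to order greater than \<open>d\<close>, so \<open>d\<close> can be made arbitrarily large; the
  polynomials \<open>p\<close> with \<open>(x\<^sub>1 + p(x\<^sub>2), x\<^sub>2) \<in> H\<close> form a translation invariant linear subspace, hence
  this subspace is everything.

  The Jung--van der Kulk theorem is obtained from Rentschler's argument: for a component \<open>f\<close> of an
  automorphism the derivation \<open>jac f\<close> is locally nilpotent, a property inherited by the leading
  form of \<open>f\<close> for any weights. Kernels of locally nilpotent derivations are factorially closed, which
  forces the Newton polygon of \<open>f\<close> to be a triangle whose leading form has a factor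
  \<open>x\<^sub>2\<^sup>k - c x\<^sub>1\<close> or \<open>x\<^sub>2 - c x\<^sub>1\<^sup>k\<close>; the corresponding shear makes the polygon smaller.
\<close>

subsection \<open>Polynomials in two variables\<close>

lemma coeff2_0 [simp]: "coeff2 0 i j = 0"
  by (simp add: coeff2_def)

lemma coeff2_add: "coeff2 (p + q) i j = coeff2 p i j + coeff2 q i j"
  by (simp add: coeff2_def)

lemma coeff2_diff: "coeff2 (p - q) i j = coeff2 p i j - coeff2 (q :: 'a::ab_group_add poly2) i j"
  by (simp add: coeff2_def)

lemma coeff2_sum: "coeff2 (sum f A) i j = (\<Sum>x\<in>A. coeff2 (f x) i j)"
  by (induction A rule: infinite_finite_induct) (auto simp: coeff2_add)

lemma poly2_eqI: "(\<And>i j. coeff2 p i j = coeff2 q i j) \<Longrightarrow> p = q"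
  by (simp add: coeff2_def poly_eq_iff)

definition const2 :: "'a::comm_ring_1 \<Rightarrow> 'a poly2" where
  "const2 a = [:[:a:]:]"

lemma const2_0 [simp]: "const2 0 = 0"
  by (simp add: const2_def)

lemma const2_1 [simp]: "const2 1 = 1"
  by (simp add: const2_def one_pCons)

lemma const2_add: "const2 (a + b) = const2 a + const2 b"
  by (simp add: const2_def)

lemma const2_diff: "const2 (a - b) = const2 a - const2 b"
  by (simp add: const2_def)

lemma const2_minus: "const2 (- a) = - const2 a"
  by (simp add: const2_def)

lemma const2_mult: "const2 (a * b) = const2 a * const2 b"
  by (simp add: const2_def)

lemma const2_power: "const2 (a ^ n) = const2 a ^ n"
  by (induction n) (simp_all add: const2_mult)

lemma const2_sum: "const2 (sum f A) = (\<Sum>x\<in>A. const2 (f x))"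
  by (induction A rule: infinite_finite_induct) (simp_all add: const2_add)

lemma const2_eq_iff [simp]: "const2 a = const2 b \<longleftrightarrow> a = b"
  by (simp add: const2_def)

lemma const2_eq_0_iff [simp]: "const2 a = 0 \<longleftrightarrow> a = 0"
  by (simp add: const2_def)

lemma coeff2_const2_mult: "coeff2 (const2 a * p) i j = a * coeff2 p i j"
  by (simp add: coeff2_def const2_def)

lemma coeff2_const2: "coeff2 (const2 a) i j = (if i = 0 \<and> j = 0 then a else 0)"
  by (auto simp: const2_def coeff2_def coeff_pCons split: nat.splits)

definition mono2 :: "'a::comm_ring_1 \<Rightarrow> nat \<Rightarrow> nat \<Rightarrow> 'a poly2" where
  "mono2 a i j = const2 a * X1 ^ i * X2 ^ j"

lemma X1_power: "X1 ^ i = [:monom 1 i:]"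
  by (induction i) (simp_all add: X1_def monom_Suc monom_0 mult.commute one_pCons)

lemma X2_power: "X2 ^ j = monom 1 j"
  by (induction j) (simp_all add: X2_def monom_Suc monom_0)

lemma mono2_eq_monom: "mono2 a i j = monom (monom a i) j"
  by (simp add: mono2_def const2_def X1_power X2_power smult_monom)

lemma coeff2_mono2: "coeff2 (mono2 a i j) k l = (if k = i \<and> l = j then a else 0)"
  by (auto simp: mono2_eq_monom coeff2_def)

lemma coeff2_X1: "coeff2 X1 i j = (if i = 1 \<and> j = 0 then 1 else 0)"
  using coeff2_mono2[of 1 1 0 i j] by (simp add: mono2_def)

lemma coeff2_X2: "coeff2 X2 i j = (if i = 0 \<and> j = 1 then 1 else 0)"
  using coeff2_mono2[of 1 0 1 i j] by (simp add: mono2_def)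

lemma poly2_sum_mono2:
  "p = (\<Sum>j\<le>degree p. \<Sum>i\<le>degree (coeff p j). mono2 (coeff2 p i j) i j)"
proof -
  have "(\<Sum>i\<le>degree (coeff p j). mono2 (coeff2 p i j) i j) = monom (coeff p j) j" for j
  proof -
    have "(\<Sum>i\<le>degree (coeff p j). mono2 (coeff2 p i j) i j)
       = monom (\<Sum>i\<le>degree (coeff p j). monom (coeff (coeff p j) i) i) j"
      by (simp add: mono2_eq_monom coeff2_def monom_sum)
    then show ?thesis by (simp add: poly_as_sum_of_monoms)
  qed
  then show ?thesis by (simp add: poly_as_sum_of_monoms)
qed

text \<open>Only monomials occurring in the given \<open>p\<close> have to be treated, so a bound on
  the support of \<open>p\<close> is available in the case \<open>mono\<close>.\<close>

lemma poly2_mono_induct [case_names zero add mono]: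
  assumes "P 0" "\<And>p q. P p \<Longrightarrow> P q \<Longrightarrow> P (p + q)"
    and mono: "\<And>i j. coeff2 p i j \<noteq> 0 \<Longrightarrow> P (mono2 (coeff2 p i j) i j)"
  shows "P p"
proof -
  have sum: "P (sum g A)" if "\<And>x. x \<in> A \<Longrightarrow> P (g x)" for g :: "nat \<Rightarrow> _" and A
    using that by (induction A rule: infinite_finite_induct) (auto intro: assms)
  have "P (mono2 (coeff2 p i j) i j)" for i j
    using mono[of i j] assms(1) by (cases "coeff2 p i j = 0") (auto simp: mono2_eq_monom)
  then show ?thesis
    by (subst poly2_sum_mono2) (intro sum)
qed

lemma subst2_const2 [simp]: "subst2 (const2 a) u v = const2 a"
  by (simp add: const2_def subst2_const)

lemma subst2_1 [simp]: "subst2 1 u v = 1"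
  using subst2_const2[of 1 u v] by simp

lemma subst2_diff: "subst2 (p - q) u v = subst2 p u v - subst2 q u v"
  by (metis add_diff_cancel_right' diff_add_cancel subst2_add)

lemma subst2_minus: "subst2 (- p) u v = - subst2 p u v"
  using subst2_diff[of 0 p u v] by simp

lemma subst2_power: "subst2 (p ^ n) u v = subst2 p u v ^ n"
  by (induction n) (simp_all add: subst2_mult)

lemma subst2_mono2: "subst2 (mono2 a i j) u v = const2 a * u ^ i * v ^ j"
  by (simp add: mono2_def subst2_mult subst2_power)

lemmas subst2_simps = subst2_add subst2_diff subst2_minus subst2_mult subst2_power

text \<open>
  The substitution \<open>x\<^sub>1 \<mapsto> t\<^sup>a x\<^sub>1, x\<^sub>2 \<mapsto> t\<^sup>b x\<^sub>2\<close> with \<open>t\<close> the outermost variable: the coefficient of \<open>t\<^sup>k\<close> is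
  the part of weight \<open>k\<close> for the weights \<open>a, b\<close>.
\<close>

definition grade :: "nat \<Rightarrow> nat \<Rightarrow> 'a::comm_ring_1 poly2 \<Rightarrow> 'a poly2 poly" where
  "grade a b p =
     poly (map_poly (\<lambda>c. poly (map_poly (\<lambda>a. [:[:[:a:]:]:]) c) (monom X1 a)) p) (monom X2 b)"

lemma grade_0 [simp]: "grade a b 0 = 0"
  by (simp add: grade_def)

lemma grade_const [simp]: "grade a b (const2 c) = [:const2 c:]"
  by (simp add: grade_def const2_def map_poly_pCons)

lemma grade_1 [simp]: "grade a b 1 = 1"
  using grade_const[of a b 1] by (simp flip: one_pCons)

lemma grade_X1 [simp]: "grade a b X1 = monom X1 a"
  unfolding grade_def X1_def[symmetric]
  by (subst X1_def) (simp add: map_poly_pCons flip: one_pCons)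

lemma grade_X2 [simp]: "grade a b X2 = monom X2 b"
  unfolding grade_def X2_def[symmetric]
  by (subst X2_def) (simp add: map_poly_pCons map_poly_1' flip: one_pCons)

lemma grade_add: "grade a b (p + q) = grade a b p + grade a b q"
  unfolding grade_def by (intro poly_map_poly_add) (auto simp: poly_map_poly_add)

lemma grade_mult: "grade a b (p * q) = grade a b p * grade a b q"
  unfolding grade_def
  by (intro poly_map_poly_mult) (auto simp: poly_map_poly_add poly_map_poly_mult)

lemma grade_diff: "grade a b (p - q) = grade a b p - grade a b q"
  by (metis add_diff_cancel_right' diff_add_cancel grade_add)

lemma grade_power: "grade a b (p ^ n) = grade a b p ^ n"
  by (induction n) (simp_all add: grade_mult)

lemma grade_mono2: "grade a b (mono2 c i j) = monom (mono2 c i j) (a * i + b * j)"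
proof -
  have "grade a b (mono2 c i j) = monom (const2 c) 0 * monom X1 a ^ i * monom X2 b ^ j"
    by (simp add: mono2_def grade_mult grade_power monom_0)
  also have "\<dots> = monom (mono2 c i j) (a * i + b * j)"
    by (simp only: monom_power mult_monom mono2_def) (simp add: mult.assoc)
  finally show ?thesis .
qed

lemma coeff2_grade:
  "coeff2 (coeff (grade a b p) k) i j = (if a * i + b * j = k then coeff2 p i j else 0)"
proof (induction p rule: poly2_mono_induct)
  case (mono i' j')
  then show ?case by (auto simp: grade_mono2 coeff2_mono2)
qed (auto simp: grade_add coeff2_add)

subsection \<open>Locally nilpotent derivations\<close>

locale derivation =
  fixes D :: "'r::{idom, ring_char_0} \<Rightarrow> 'r"
  assumes D_add: "D (a + b) = D a + D b"
    and D_mult: "D (a * b) = D a * b + a * D b"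
begin

lemma D_0 [simp]: "D 0 = 0"
  using D_add[of 0 0] by simp

lemma D_1 [simp]: "D 1 = 0"
  using D_mult[of 1 1] by simp

lemma D_of_nat [simp]: "D (of_nat n) = 0"
  by (induction n) (simp_all add: D_add)

lemma D_minus: "D (- a) = - D a"
  using D_add[of a "- a"] by (simp add: eq_neg_iff_add_eq_0 add.commute)

lemma D_diff: "D (a - b) = D a - D b"
  using D_add[of a "- b"] by (simp add: D_minus)

lemma D_power: "D (a ^ n) = of_nat n * a ^ (n - 1) * D a"
proof (induction n)
  case (Suc n)
  then show ?case
    by (cases n) (simp_all add: D_mult algebra_simps)
qed simp

lemma funpow_D_0 [simp]: "(D ^^ n) 0 = 0"
  by (induction n) simp_all

lemma funpow_D_add: "(D ^^ n) (a + b) = (D ^^ n) a + (D ^^ n) b"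
  by (induction n) (simp_all add: D_add)

lemma funpow_D_Suc: "(D ^^ Suc n) a = (D ^^ n) (D a)"
  by (simp add: funpow_swap1)

lemma funpow_D_eq_0_mono:
  assumes "(D ^^ m) a = 0" "m \<le> n"
  shows "(D ^^ n) a = 0"
proof -
  have "(D ^^ n) a = (D ^^ (n - m)) ((D ^^ m) a)"
    using assms(2) by (simp flip: funpow_add[THEN fun_cong, unfolded comp_def])
  then show ?thesis using assms by simp
qed

text \<open>
  Only the extreme term of the Leibniz formula survives at the sum of the two orders.
\<close>

lemma funpow_D_mult:
  assumes "(D ^^ Suc m) a = 0" "(D ^^ Suc n) b = 0"
  shows "(D ^^ (m + n)) (a * b) = of_nat ((m + n) choose m) * (D ^^ m) a * (D ^^ n) b"
  using assms
proof (induction "m + n" arbitrary: m n a b)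
  case (Suc k)
  have left: "(D ^^ k) (D a * b) = of_nat (k choose i) * (D ^^ m) a * (D ^^ n) b"
    if m: "m = Suc i" for i
  proof -
    have "k = i + n" "(D ^^ Suc i) (D a) = 0"
      using Suc m by (simp_all add: funpow_swap1)
    from Suc(1)[OF this Suc(4)] show ?thesis
      using \<open>k = i + n\<close> m by (simp add: funpow_swap1)
  qed
  have right: "(D ^^ k) (a * D b) = of_nat (k choose m) * (D ^^ m) a * (D ^^ n) b"
    if n: "n = Suc i" for i
  proof -
    have "k = m + i" "(D ^^ Suc i) (D b) = 0"
      using Suc n by (simp_all add: funpow_swap1)
    from Suc(1)[OF this(1) Suc(3) this(2)] show ?thesis
      using \<open>k = m + i\<close> n by (simp add: funpow_swap1)
  qed
  have *: "(D ^^ (m + n)) (a * b) = (D ^^ k) (D a * b) + (D ^^ k) (a * D b)"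
    unfolding Suc(2)[symmetric] funpow_D_Suc D_mult funpow_D_add ..
  show ?case
  proof (cases m)
    case 0
    then obtain i where "n = Suc i" "k = i" using Suc(2) by auto
    with 0 Suc(3) show ?thesis using * right by simp
  next
    case m: (Suc i)
    show ?thesis
    proof (cases n)
      case 0
      then show ?thesis using Suc(2,4) * left[OF m] m by simp
    next
      case n: (Suc j)
      have "(m + n) choose m = (k choose i) + (k choose m)"
        using m Suc(2) by (metis binomial_Suc_Suc)
      then show ?thesis
        unfolding * left[OF m] right[OF n] by (simp add: algebra_simps)
    qed
  qed
qed simp

definition nilp :: "'r \<Rightarrow> bool" where
  "nilp a \<longleftrightarrow> (\<exists>n. (D ^^ n) a = 0)"

lemma nilpI: "(D ^^ n) a = 0 \<Longrightarrow> nilp a"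
  by (auto simp: nilp_def)

lemma nilp_add:
  assumes "nilp a" "nilp b"
  shows "nilp (a + b)"
proof -
  obtain m n where mn: "(D ^^ m) a = 0" "(D ^^ n) b = 0"
    using assms by (auto simp: nilp_def)
  have "(D ^^ (m + n)) (a + b) = 0"
    using funpow_D_eq_0_mono[OF mn(1), of "m + n"] funpow_D_eq_0_mono[OF mn(2), of "m + n"]
    by (simp add: funpow_D_add)
  then show ?thesis by (rule nilpI)
qed

lemma nilp_mult:
  assumes "nilp a" "nilp b"
  shows "nilp (a * b)"
proof -
  obtain m n where "(D ^^ m) a = 0" "(D ^^ n) b = 0"
    using assms by (auto simp: nilp_def)
  then have mn: "(D ^^ Suc m) a = 0" "(D ^^ Suc n) b = 0"
    by simp_all
  then have "(D ^^ Suc (m + n)) (a * b) = 0"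
    using funpow_D_mult[OF mn] by (simp add: D_mult)
  then show ?thesis by (rule nilpI)
qed

text \<open>The degree function of the derivation: on a nonzero element satisfying
  \<open>nilp\<close> it is the last exponent whose iterate does not vanish.\<close>

definition nu :: "'r \<Rightarrow> nat" where
  "nu a = (LEAST n. (D ^^ Suc n) a = 0)"

lemma funpow_nu:
  assumes "nilp a" "a \<noteq> 0"
  shows "(D ^^ Suc (nu a)) a = 0" "(D ^^ nu a) a \<noteq> 0"
proof -
  obtain n where "(D ^^ n) a = 0" using assms by (auto simp: nilp_def)
  then have "(D ^^ Suc n) a = 0" by simp
  then show "(D ^^ Suc (nu a)) a = 0"
    unfolding nu_def by (rule LeastI)
  show "(D ^^ nu a) a \<noteq> 0"
  proof (cases "nu a")
    case 0
    then show ?thesis using assms by simp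
  next
    case (Suc m)
    then have "m < (LEAST n. (D ^^ Suc n) a = 0)" by (simp add: nu_def)
    from not_less_Least[OF this] show ?thesis by (simp only: Suc not_False_eq_True)
  qed
qed

lemma nu_eqI:
  assumes "(D ^^ n) a \<noteq> 0" "(D ^^ Suc n) a = 0"
  shows "nu a = n"
  unfolding nu_def
proof (rule Least_equality)
  show "n \<le> m" if "(D ^^ Suc m) a = 0" for m
    using assms(1) funpow_D_eq_0_mono[OF that, of n] by (meson not_less_eq_eq)
qed (use assms in auto)

text \<open>By \<open>funpow_D_mult\<close> the last iterate is a binomial coefficient times two
  nonzero elements, hence nonzero in a domain of characteristic zero.\<close>

lemma nu_mult:
  assumes "nilp a" "a \<noteq> 0" "nilp b" "b \<noteq> 0"
  shows "nu (a * b) = nu a + nu b"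
proof (rule nu_eqI)
  note a = funpow_nu[OF assms(1,2)] and b = funpow_nu[OF assms(3,4)]
  note * = funpow_D_mult[OF a(1) b(1)]
  show "(D ^^ (nu a + nu b)) (a * b) \<noteq> 0"
    using a(2) b(2) by (simp add: *)
  show "(D ^^ Suc (nu a + nu b)) (a * b) = 0"
    using a(1) b(1) by (simp add: * D_mult)
qed

lemma nu_D:
  assumes "nilp a" "D a \<noteq> 0"
  shows "nu a = Suc (nu (D a))"
proof -
  obtain n where "(D ^^ n) a = 0"
    using assms(1) by (auto simp: nilp_def)
  then have "(D ^^ Suc n) a = 0"
    by simp
  then have "nilp (D a)"
    unfolding funpow_D_Suc by (rule nilpI)
  note * = funpow_nu[OF this assms(2)]
  have "(D ^^ Suc (nu (D a))) a \<noteq> 0"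
    using *(2) by (simp only: funpow_D_Suc not_False_eq_True)
  moreover have "(D ^^ Suc (Suc (nu (D a)))) a = 0"
    using *(1) by (simp only: funpow_D_Suc)
  ultimately show ?thesis by (rule nu_eqI)
qed

lemma nu_eq_0_iff:
  assumes "nilp a" "a \<noteq> 0"
  shows "nu a = 0 \<longleftrightarrow> D a = 0"
proof
  assume "nu a = 0"
  then show "D a = 0" using funpow_nu(1)[OF assms] by simp
next
  assume "D a = 0"
  then show "nu a = 0" using assms(2) by (intro nu_eqI) simp_all
qed

text \<open>Since \<open>nu\<close> is additive on products and takes values in the natural numbers,
  \<open>nu (a * b) = 0\<close> forces \<open>nu a = 0\<close>: the kernel is factorially
  closed.\<close>

lemma kernel_factor:
  assumes "nilp a" "nilp b" "a * b \<noteq> 0" "D (a * b) = 0"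
  shows "D a = 0"
proof -
  have "a \<noteq> 0" "b \<noteq> 0" using assms(3) by auto
  then show ?thesis
    using nu_mult[OF assms(1) _ assms(2)] nu_eq_0_iff[OF nilp_mult[OF assms(1,2)] assms(3)]
      nu_eq_0_iff[OF assms(1)] assms(4) by simp
qed

text \<open>Divisors of a nonzero element have at most its \<open>nu\<close>, while \<open>D\<close>
  lowers \<open>nu\<close> by one; mutual divisibility would give \<open>nu a < nu b\<close> and
  \<open>nu b < nu a\<close>.\<close>

lemma not_mutually_dvd:
  assumes all: "\<And>p. nilp p" and "D a \<noteq> 0" "D b \<noteq> 0"
  shows "\<not> (a dvd D b \<and> b dvd D a)"
proof
  assume *: "a dvd D b \<and> b dvd D a"
  have "nu x \<le> nu y" if "x dvd y" "y \<noteq> 0" for x y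
    using that nu_mult[OF all _ all] by (elim dvdE) simp
  then have "nu a \<le> nu (D b)" "nu b \<le> nu (D a)"
    using * assms by blast+
  then show False
    using nu_D[OF all assms(2)] nu_D[OF all assms(3)] by linarith
qed

end

subsection \<open>The Jacobian derivation\<close>

definition dx :: "'a::idom poly2 \<Rightarrow> 'a poly2" where
  "dx p = map_poly pderiv p"

definition dy :: "'a::idom poly2 \<Rightarrow> 'a poly2" where
  "dy p = pderiv p"

lemma coeff2_dx: "coeff2 (dx p) i j = of_nat (Suc i) * coeff2 p (Suc i) j"
  by (simp add: coeff2_def dx_def coeff_map_poly coeff_pderiv)

lemma coeff2_dy: "coeff2 (dy p) i j = of_nat (Suc j) * coeff2 p i (Suc j)"
proof -
  have "coeff (of_nat (Suc j) * q) i = of_nat (Suc j) * coeff q i" for q :: "'a poly"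
    by (simp add: of_nat_poly)
  then show ?thesis
    unfolding coeff2_def dy_def coeff_pderiv .
qed

lemma dx_add: "dx (p + q) = dx p + dx q"
  by (rule poly2_eqI) (simp add: coeff2_dx coeff2_add algebra_simps)

lemma dy_add: "dy (p + q) = dy p + dy q"
  by (simp add: dy_def pderiv_add)

lemma dy_mult: "dy (p * q) = dy p * q + p * dy q"
  by (simp add: dy_def pderiv_mult mult.commute add.commute)

lemma dx_mult: "dx (p * q) = dx p * q + p * dx q"
proof (induction p)
  case (pCons c p)
  have smult: "dx (smult c q) = smult (pderiv c) q + smult c (dx q)" for c q
    by (rule poly_eqI) (simp add: dx_def coeff_map_poly pderiv_mult algebra_simps)
  have shift: "dx (pCons c q) = pCons (pderiv c) (dx q)" for c and q :: "'a poly2"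
    by (simp add: dx_def map_poly_pCons)
  have "dx (pCons c p * q) = dx (smult c q) + dx (pCons 0 (p * q))"
    by (simp add: dx_add)
  also have "\<dots> = dx (pCons c p) * q + pCons c p * dx q"
    by (simp add: smult shift pCons algebra_simps)
  finally show ?case .
qed (simp add: dx_def)

lemma dx_const2 [simp]: "dx (const2 a) = 0"
  by (rule poly2_eqI) (simp add: coeff2_dx coeff2_const2)

lemma dy_const2 [simp]: "dy (const2 a) = 0"
  by (rule poly2_eqI) (simp add: coeff2_dy coeff2_const2)

lemma coeff2_1: "coeff2 1 i j = (if i = 0 \<and> j = 0 then 1 else 0 :: 'a::comm_ring_1)"
  using coeff2_const2[of 1 i j] by simp

lemma dx_X1 [simp]: "dx X1 = 1"
  by (rule poly2_eqI) (simp add: coeff2_dx coeff2_dy coeff2_X1 coeff2_X2 coeff2_1)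

lemma dx_X2 [simp]: "dx X2 = 0"
  by (rule poly2_eqI) (simp add: coeff2_dx coeff2_dy coeff2_X1 coeff2_X2 coeff2_1)

lemma dy_X1 [simp]: "dy X1 = 0"
  by (rule poly2_eqI) (simp add: coeff2_dx coeff2_dy coeff2_X1 coeff2_X2 coeff2_1)

lemma dy_X2 [simp]: "dy X2 = 1"
  by (rule poly2_eqI) (simp add: coeff2_dx coeff2_dy coeff2_X1 coeff2_X2 coeff2_1)

lemma dx_subst2: "dx (subst2 p u v) = subst2 (dx p) u v * dx u + subst2 (dy p) u v * dx v"
  by (induction p rule: poly2_induct)
     (simp_all add: subst2_simps dx_add dy_add dx_mult dy_mult algebra_simps flip: const2_def)

lemma dy_subst2: "dy (subst2 p u v) = subst2 (dx p) u v * dy u + subst2 (dy p) u v * dy v"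
  by (induction p rule: poly2_induct)
     (simp_all add: subst2_simps dx_add dy_add dx_mult dy_mult algebra_simps flip: const2_def)

definition jac :: "'a::idom poly2 \<Rightarrow> 'a poly2 \<Rightarrow> 'a poly2" where
  "jac f g = dx f * dy g - dy f * dx g"

lemma jac_subst2: "jac (subst2 f u v) (subst2 g u v) = subst2 (jac f g) u v * jac u v"
  by (simp add: jac_def dx_subst2 dy_subst2 subst2_simps algebra_simps)

lemma derivation_jac: "derivation (jac (f :: 'a::{idom, ring_char_0} poly2))"
  by unfold_locales (simp_all add: jac_def dx_add dy_add dx_mult dy_mult algebra_simps)

lemma jac_self: "jac f f = 0"
  by (simp add: jac_def)

lemma jac_X1: "jac f X1 = - dy f" and jac_X2: "jac f X2 = dx f"
  by (simp_all add: jac_def)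

subsection \<open>Leading forms for weighted degrees\<close>

lemma coeff_mult_degree_le:
  assumes "degree A \<le> m" "degree B \<le> n"
  shows "coeff (A * B) (m + n) = coeff A m * coeff B n"
proof (cases "degree A = m \<and> degree B = n")
  case True
  then show ?thesis using coeff_mult_degree_sum[of A B] by simp
next
  case False
  then have "degree (A * B) < m + n"
    using degree_mult_le[of A B] assms by linarith
  moreover have "coeff A m = 0 \<or> coeff B n = 0"
    using False assms by (metis coeff_eq_0 le_neq_implies_less)
  ultimately show ?thesis by (auto simp: coeff_eq_0)
qed

lemma dx_mono2: "dx (mono2 c i j) = mono2 (of_nat i * c) (i - 1) j"
  by (cases i; rule poly2_eqI) (auto simp: coeff2_dx coeff2_mono2)

lemma dy_mono2: "dy (mono2 c i j) = mono2 (of_nat j * c) i (j - 1)"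
  by (cases j; rule poly2_eqI) (auto simp: coeff2_dy coeff2_mono2)

lemma dx_0 [simp]: "dx 0 = 0" and dy_0 [simp]: "dy 0 = 0"
  by (simp_all add: dx_def dy_def)

lemma mono2_0 [simp]: "mono2 0 i j = 0"
  by (simp add: mono2_def)

lemma map_poly_additive:
  assumes "h 0 = 0" "\<And>x y. h (x + y) = h x + h y"
  shows "map_poly h (p + q) = map_poly h p + map_poly h q"
  by (rule poly_eqI) (simp add: coeff_map_poly assms)

text \<open>Differentiation in \<open>X1\<close> lowers the weight by \<open>a\<close>; the factor
  \<open>monom 1 a\<close> restores it.\<close>

lemma map_dx_grade: "map_poly dx (grade a b p) = monom 1 a * grade a b (dx p)"
proof (induction p rule: poly2_mono_induct)
  case (mono i j)
  then show ?case
    by (cases i) (simp_all add: grade_mono2 dx_mono2 map_poly_monom mult_monom algebra_simps)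
qed (simp_all add: grade_add dx_add map_poly_additive algebra_simps)

lemma map_dy_grade: "map_poly dy (grade a b p) = monom 1 b * grade a b (dy p)"
proof (induction p rule: poly2_mono_induct)
  case (mono i j)
  then show ?case
    by (cases j) (simp_all add: grade_mono2 dy_mono2 map_poly_monom mult_monom algebra_simps)
qed (simp_all add: grade_add dy_add map_poly_additive algebra_simps)

text \<open>The Jacobian bracket with the grading variable treated as a constant, so that all
  weighted parts are handled at once.\<close>

definition graded_jac :: "'a::idom poly2 poly \<Rightarrow> 'a poly2 poly \<Rightarrow> 'a poly2 poly" where
  "graded_jac \<Phi> P = map_poly dx \<Phi> * map_poly dy P - map_poly dy \<Phi> * map_poly dx P"

lemma graded_jac_grade:
  "graded_jac (grade a b f) (grade a b p) = monom 1 (a + b) * grade a b (jac f p)"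
proof -
  have "monom 1 (a + b) = (monom 1 a * monom 1 b :: 'a poly2 poly)"
    by (simp add: mult_monom)
  then show ?thesis
    by (simp add: graded_jac_def map_dx_grade map_dy_grade jac_def grade_diff grade_mult
        algebra_simps)
qed

lemma graded_jac_monom_mult:
  "graded_jac \<Phi> (monom 1 k * P) = monom 1 k * graded_jac \<Phi> P"
proof -
  have "map_poly h (monom 1 k * P) = monom 1 k * map_poly h P"
    if "h 0 = 0" for h :: "'a poly2 \<Rightarrow> 'a poly2"
    by (rule poly_eqI) (simp add: coeff_monom_mult coeff_map_poly that)
  then show ?thesis
    by (simp add: graded_jac_def algebra_simps)
qed

lemma funpow_graded_jac_grade:
  "(graded_jac (grade a b f) ^^ n) (grade a b p)
     = monom 1 (n * (a + b)) * grade a b ((jac f ^^ n) p)"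
proof (induction n)
  case (Suc n)
  have "(graded_jac (grade a b f) ^^ Suc n) (grade a b p)
      = monom 1 (n * (a + b)) * (monom 1 (a + b) * grade a b (jac f ((jac f ^^ n) p)))"
    by (simp add: Suc graded_jac_monom_mult graded_jac_grade)
  also have "\<dots> = monom 1 (Suc n * (a + b)) * grade a b ((jac f ^^ Suc n) p)"
    by (simp add: mult_monom flip: mult.assoc) (simp add: add.commute add.left_commute)
  finally show ?case .
qed (simp flip: one_pCons add: monom_0)

lemma graded_jac_top:
  assumes "degree \<Phi> \<le> d" "degree P \<le> e"
  shows "degree (graded_jac \<Phi> P) \<le> d + e"
    and "coeff (graded_jac \<Phi> P) (d + e) = jac (coeff \<Phi> d) (coeff P e)"
proof -
  have le: "degree (map_poly h Q) \<le> k" if "degree Q \<le> k" for h :: "'a poly2 \<Rightarrow> 'a poly2" and Q k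
    using map_poly_degree_leq[of h Q] that by linarith
  show "degree (graded_jac \<Phi> P) \<le> d + e"
    unfolding graded_jac_def
    by (intro degree_diff_le order_trans[OF degree_mult_le] add_mono le assms)
  show "coeff (graded_jac \<Phi> P) (d + e) = jac (coeff \<Phi> d) (coeff P e)"
    unfolding graded_jac_def coeff_diff jac_def
    by (simp add: coeff_mult_degree_le le assms coeff_map_poly)
qed

text \<open>Top coefficients are moved by the leading form alone. As \<open>d\<close> and
  \<open>e\<close> are mere bounds, cancellation at the top does not stop the iteration.\<close>

lemma funpow_graded_jac_top:
  assumes "degree \<Phi> \<le> d" "degree P \<le> e"
  shows "degree ((graded_jac \<Phi> ^^ n) P) \<le> n * d + e \<and>
    coeff ((graded_jac \<Phi> ^^ n) P) (n * d + e) = (jac (coeff \<Phi> d) ^^ n) (coeff P e)"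
proof (induction n)
  case (Suc n)
  then show ?case
    using graded_jac_top[OF assms(1), of "(graded_jac \<Phi> ^^ n) P" "n * d + e"]
    by (simp add: add.assoc)
qed (use assms in simp)

lemma (in derivation) nilp_kernel: "D a = 0 \<Longrightarrow> nilp a"
  by (rule nilpI[of 1]) simp

definition lnd :: "('a::{idom, ring_char_0} poly2 \<Rightarrow> 'a poly2) \<Rightarrow> bool" where
  "lnd D \<longleftrightarrow> (\<forall>p. \<exists>n. (D ^^ n) p = 0)"

text \<open>The nilpotent elements are closed under sums and products and contain the constants, so
  the two variables are enough.\<close>

lemma lnd_jacI:
  fixes f :: "'a::{idom, ring_char_0} poly2"
  assumes "(jac f ^^ k) X1 = 0" "(jac f ^^ l) X2 = 0"
  shows "lnd (jac f)"
proof -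
  interpret derivation "jac f" by (rule derivation_jac)
  have "nilp p" for p
  proof (induction p rule: poly2_induct)
    case (const a)
    then show ?case
      unfolding const2_def[symmetric] by (intro nilp_kernel) (simp add: jac_def)
  qed (use assms nilpI nilp_add nilp_mult in auto)
  then show ?thesis by (auto simp: lnd_def nilp_def)
qed

text \<open>If an iterate of \<open>jac f\<close> kills \<open>p\<close>, the same iterate of
  \<open>graded_jac\<close> kills \<open>grade a b p\<close>; its top coefficient is the iterate for
  the leading form, applied to the top part of \<open>p\<close>. Both variables are homogeneous, so
  they are their own top parts.\<close>

lemma lnd_leading_form:
  fixes f :: "'a::{idom, ring_char_0} poly2"
  assumes "lnd (jac f)" "degree (grade a b f) \<le> d"
  shows "lnd (jac (coeff (grade a b f) d))"
proof -
  have *: "\<exists>n. (jac (coeff (grade a b f) d) ^^ n) (coeff (grade a b p) e) = 0"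
    if "degree (grade a b p) \<le> e" for p e
  proof -
    obtain n where "(jac f ^^ n) p = 0" using assms(1) by (auto simp: lnd_def)
    then show ?thesis
      using funpow_graded_jac_top[OF assms(2) that, of n] funpow_graded_jac_grade[of n a b f p]
      by auto
  qed
  from *[of X1 a] *[of X2 b] show ?thesis
    by (auto simp: degree_monom_le intro: lnd_jacI)
qed

section \<open>Jacobians of automorphisms\<close>

lemma carrier_GA2_iff:
  "\<sigma> \<in> carrier GA2 \<longleftrightarrow> (\<exists>\<tau>. comp2 \<tau> \<sigma> = (X1, X2) \<and> comp2 \<sigma> \<tau> = (X1, X2))"
  by (auto simp: GA2_def units_of_def Units_def End2_def)

text \<open>The chain rule, applied to an automorphism and its inverse, makes the Jacobian a unit of
  the polynomial ring.\<close>

lemma jac_GA2: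
  fixes \<sigma> :: "'a::idom end2"
  assumes "\<sigma> \<in> carrier GA2"
  obtains c where "c \<noteq> 0" "jac (fst \<sigma>) (snd \<sigma>) = const2 c"
proof -
  obtain \<tau> where "subst2 (fst \<tau>) (fst \<sigma>) (snd \<sigma>) = X1" "subst2 (snd \<tau>) (fst \<sigma>) (snd \<sigma>) = X2"
    using assms by (auto simp: carrier_GA2_iff comp2_def)
  then have "jac X1 X2 = subst2 (jac (fst \<tau>) (snd \<tau>)) (fst \<sigma>) (snd \<sigma>) * jac (fst \<sigma>) (snd \<sigma>)"
    using jac_subst2 by metis
  moreover have "jac X1 X2 = (1 :: 'a poly2)"
    by (simp add: jac_def)
  ultimately have "jac (fst \<sigma>) (snd \<sigma>) dvd 1"
    by (metis dvd_triv_right)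
  then obtain c where "jac (fst \<sigma>) (snd \<sigma>) = const2 c" "c dvd 1"
    by (auto simp: is_unit_poly_iff const2_def)
  moreover from this have "c \<noteq> 0"
    by (metis dvd_0_left zero_neq_one)
  ultimately show ?thesis using that by blast
qed

text \<open>In the coordinates given by the components of \<open>\<sigma>\<close>, the derivation
  \<open>jac (fst \<sigma>)\<close> is a constant multiple of the partial derivative along
  \<open>snd \<sigma>\<close>; every polynomial is a polynomial in these coordinates.\<close>

lemma lnd_GA2:
  fixes \<sigma> :: "'a::{idom, ring_char_0} end2"
  assumes "\<sigma> \<in> carrier GA2"
  shows "lnd (jac (fst \<sigma>))"
proof -
  interpret derivation "jac (fst \<sigma>)" by (rule derivation_jac)
  obtain c where c: "jac (fst \<sigma>) (snd \<sigma>) = const2 c" using jac_GA2[OF assms] .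
  have const: "nilp (const2 a)" for a
    by (intro nilp_kernel) (simp add: jac_def)
  have "nilp (snd \<sigma>)"
    by (rule nilpI[of 2]) (simp add: numeral_2_eq_2 c, simp add: jac_def)
  then have *: "nilp (subst2 p (fst \<sigma>) (snd \<sigma>))" for p
  proof (induction p rule: poly2_induct)
    case (const a)
    then show ?case using \<open>nilp (const2 a)\<close> by (simp add: subst2_const const2_def)
  qed (auto simp: subst2_simps jac_self intro: nilp_add nilp_mult nilp_kernel)
  obtain \<tau> where "subst2 (fst \<tau>) (fst \<sigma>) (snd \<sigma>) = X1" "subst2 (snd \<tau>) (fst \<sigma>) (snd \<sigma>) = X2"
    using assms by (auto simp: carrier_GA2_iff comp2_def)
  then have "nilp X1" "nilp X2" using * by metis+
  then show ?thesis
    unfolding nilp_def using lnd_jacI by blast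
qed

section \<open>Divisibility by a variable\<close>

lemma X2_dvd_iff: "X2 dvd p \<longleftrightarrow> (\<forall>i. coeff2 p i 0 = 0)" for p :: "'a::idom poly2"
proof -
  have "X2 dvd p \<longleftrightarrow> poly p 0 = 0"
    using poly_eq_0_iff_dvd[of p 0] by (simp add: X2_def)
  then show ?thesis
    by (simp add: poly_0_coeff_0 coeff2_def poly_eq_iff)
qed

lemma X1_dvd_iff: "X1 dvd p \<longleftrightarrow> (\<forall>j. coeff2 p 0 j = 0)" for p :: "'a::idom poly2"
proof -
  have "[:0, 1:] dvd c \<longleftrightarrow> coeff c 0 = 0" for c :: "'a poly"
    using poly_eq_0_iff_dvd[of c 0] by (simp add: poly_0_coeff_0)
  then show ?thesis
    by (simp add: X1_def const_poly_dvd_iff coeff2_def)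
qed

text \<open>The derivation \<open>jac F\<close> kills \<open>F\<close> itself, and its kernel is
  factorially closed.\<close>

lemma lnd_jac_kernel_factor:
  assumes "lnd (jac F)" "F \<noteq> 0" "h dvd F"
  shows "jac F h = 0"
proof -
  interpret derivation "jac F" by (rule derivation_jac)
  have all: "nilp p" for p using assms(1) by (simp add: lnd_def nilp_def)
  obtain q where q: "F = h * q" using assms(3) by (elim dvdE)
  have "jac F (h * q) = 0" unfolding q[symmetric] by (rule jac_self)
  with kernel_factor[OF all all] assms(2) q show ?thesis by metis
qed

lemma X2_dvd_lnd: "lnd (jac F) \<Longrightarrow> F \<noteq> 0 \<Longrightarrow> X2 dvd F \<Longrightarrow> dx F = 0"
  and X1_dvd_lnd: "lnd (jac F) \<Longrightarrow> F \<noteq> 0 \<Longrightarrow> X1 dvd F \<Longrightarrow> dy F = 0"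
  using lnd_jac_kernel_factor[of F X2] lnd_jac_kernel_factor[of F X1]
  by (auto simp: jac_X1 jac_X2)

subsection \<open>Newton polygons of coordinates\<close>

text \<open>A rectangle containing the Newton polygon; \<open>n + m\<close> is the measure that the
  reduction by shears decreases.\<close>

definition box :: "nat \<Rightarrow> nat \<Rightarrow> 'a::zero poly2 \<Rightarrow> bool" where
  "box n m f \<longleftrightarrow> (\<forall>i j. coeff2 f i j \<noteq> 0 \<longrightarrow> i \<le> n \<and> j \<le> m)"

lemma degree_grade_le:
  assumes "\<And>i j. coeff2 f i j \<noteq> 0 \<Longrightarrow> a * i + b * j \<le> d"
  shows "degree (grade a b f) \<le> d"
proof (rule degree_le, intro allI impI)
  fix e assume "d < e"
  then show "coeff (grade a b f) e = 0"
    using assms by (intro poly2_eqI) (fastforce simp: coeff2_grade)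
qed

lemma dx_eq_0D: "dx p = 0 \<Longrightarrow> i > 0 \<Longrightarrow> coeff2 p i j = 0"
  for p :: "'a::{idom, ring_char_0} poly2"
  using coeff2_dx[of p "i - 1" j] by (simp del: of_nat_Suc)

lemma dy_eq_0D: "dy p = 0 \<Longrightarrow> j > 0 \<Longrightarrow> coeff2 p i j = 0"
  for p :: "'a::{idom, ring_char_0} poly2"
  using coeff2_dy[of p i "j - 1"] by (simp del: of_nat_Suc)

text \<open>The leading form for the weights 0 and 1 is divisible by \<open>X2\<close>, hence free
  of \<open>X1\<close>: the top side of the box carries at most a pure power of
  \<open>X2\<close>.\<close>

lemma lnd_top_right:
  fixes f :: "'a::{idom, ring_char_0} poly2"
  assumes "lnd (jac f)" "box n m f" "m > 0" "coeff2 f i m \<noteq> 0"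
  shows "i = 0"
proof (rule ccontr)
  assume "i \<noteq> 0"
  define F where "F = coeff (grade 0 1 f) m"
  have F: "coeff2 F i j = (if j = m then coeff2 f i j else 0)" for i j
    by (auto simp: F_def coeff2_grade)
  have "lnd (jac F)"
    unfolding F_def using assms(1,2) by (intro lnd_leading_form degree_grade_le) (auto simp: box_def)
  moreover have "F \<noteq> 0" using F[of i m] assms(4) by auto
  moreover have "X2 dvd F" using assms(3) by (simp add: X2_dvd_iff F)
  ultimately have "dx F = 0" by (rule X2_dvd_lnd)
  then show False using dx_eq_0D[of F i m] F[of i m] assms(4) \<open>i \<noteq> 0\<close> by simp
qed

lemma lnd_right_top:
  fixes f :: "'a::{idom, ring_char_0} poly2"
  assumes "lnd (jac f)" "box n m f" "n > 0" "coeff2 f n j \<noteq> 0"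
  shows "j = 0"
proof (rule ccontr)
  assume "j \<noteq> 0"
  define F where "F = coeff (grade 1 0 f) n"
  have F: "coeff2 F i j = (if i = n then coeff2 f i j else 0)" for i j
    by (auto simp: F_def coeff2_grade)
  have "lnd (jac F)"
    unfolding F_def using assms(1,2) by (intro lnd_leading_form degree_grade_le) (auto simp: box_def)
  moreover have "F \<noteq> 0" using F[of n j] assms(4) by auto
  moreover have "X1 dvd F" using assms(3) by (simp add: X1_dvd_iff F)
  ultimately have "dy F = 0" by (rule X1_dvd_lnd)
  then show False using dy_eq_0D[of F j n] F[of n j] assms(4) \<open>j \<noteq> 0\<close> by simp
qed

text \<open>
  A monomial strictly beyond the edge would give a leading form divisible by both variables.
\<close>

lemma lnd_below_edge:
  fixes f :: "'a::{idom, ring_char_0} poly2"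
  assumes lnd: "lnd (jac f)" and box: "box n m f" and nonzero: "coeff2 f i j \<noteq> 0"
    and edge: "a * n = d" "b * m = d"
  shows "a * i + b * j \<le> d"
proof (rule ccontr)
  assume beyond: "\<not> a * i + b * j \<le> d"
  define e where "e = degree (grade a b f)"
  define F where "F = coeff (grade a b f) e"
  have F: "coeff2 F i j = (if a * i + b * j = e then coeff2 f i j else 0)" for i j
    by (simp add: F_def coeff2_grade)
  have "coeff (grade a b f) (a * i + b * j) \<noteq> 0"
    using nonzero coeff2_grade[of a b f "a * i + b * j" i j] by auto
  then have "a * i + b * j \<le> e"
    unfolding e_def by (rule le_degree)
  then have "d < e" using beyond by simp
  have "grade a b f \<noteq> 0"
    using \<open>coeff (grade a b f) (a * i + b * j) \<noteq> 0\<close> by auto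
  then have "F \<noteq> 0" by (simp add: F_def e_def)
  \<comment> \<open>On a coordinate axis, a monomial inside the box has weight at most
    \<open>d\<close>, which is less than \<open>e\<close>.\<close>
  have pos: "i > 0 \<and> j > 0" if "coeff2 F i j \<noteq> 0" for i j
  proof -
    have *: "a * i + b * j = e" "i \<le> n" "j \<le> m"
      using that box by (auto simp: F box_def split: if_splits)
    then have "a * i \<le> d" "b * j \<le> d"
      using edge by (metis mult_le_mono2)+
    then show ?thesis using *(1) \<open>d < e\<close> by (auto intro!: Nat.gr0I)
  qed
  have "lnd (jac F)"
    unfolding F_def e_def by (rule lnd_leading_form[OF lnd order_refl])
  moreover have "X2 dvd F" unfolding X2_dvd_iff using pos by blast
  ultimately have "dx F = 0" using \<open>F \<noteq> 0\<close> by (intro X2_dvd_lnd)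
  then have "coeff2 F i j = 0" for i j
    using pos[of i j] dx_eq_0D by blast
  then have "F = 0" by (intro poly2_eqI) simp
  then show False using \<open>F \<noteq> 0\<close> by simp
qed

text \<open>Coprimality of the weights forces every monomial to be a product of powers of
  \<open>U = X1 ^ q\<close> and \<open>V = X2 ^ p\<close>. So \<open>F\<close> is a binary form of
  degree \<open>g\<close> in \<open>U\<close> and \<open>V\<close>, and a root of it gives a linear
  factor.\<close>

lemma binomial_factor_of_quasihomogeneous:
  fixes F :: "'a::alg_closed_field poly2"
  assumes "coprime p q" "p > 0" "q > 0" "g > 0"
    and hom: "\<And>i j. coeff2 F i j \<noteq> 0 \<Longrightarrow> p * i + q * j = g * p * q"
    and ends: "coeff2 F 0 (g * p) \<noteq> 0" "coeff2 F (g * q) 0 \<noteq> 0"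
  obtains c where "c \<noteq> 0" "X2 ^ p - const2 c * X1 ^ q dvd F"
proof -
  define e where "e a = coeff2 F (q * (g - a)) (p * a)" for a
  define U :: "'a poly2" where "U = X1 ^ q"
  define V :: "'a poly2" where "V = X2 ^ p"
  have supp: "\<exists>a\<le>g. i = q * (g - a) \<and> j = p * a" if "coeff2 F i j \<noteq> 0" for i j
  proof -
    have *: "p * i + q * j = g * p * q" by (rule hom[OF that])
    have "p dvd g * p * q" "p dvd p * i" by simp_all
    then have "p dvd q * j"
      using * by (metis dvd_add_right_iff)
    then obtain a where a: "j = p * a"
      using assms(1) by (auto simp: coprime_dvd_mult_right_iff)
    have "p * (i + q * a) = p * (q * g)"
      using * a by (simp add: algebra_simps)
    then have ia: "i + q * a = q * g" using assms(2) by simp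
    then have "q * a \<le> q * g" by linarith
    then have "a \<le> g" using assms(3) by simp
    then show ?thesis using ia a by (auto simp: diff_mult_distrib2 intro!: exI[of _ a])
  qed
  have "F = (\<Sum>a\<le>g. mono2 (e a) (q * (g - a)) (p * a))" (is "_ = ?S")
  proof (rule poly2_eqI)
    fix i j
    show "coeff2 F i j = coeff2 ?S i j"
    proof (cases "\<exists>a\<le>g. i = q * (g - a) \<and> j = p * a")
      case True
      then obtain a where a: "a \<le> g" "i = q * (g - a)" "j = p * a" by blast
      have "coeff2 ?S i j = (\<Sum>b\<le>g. if b = a then e a else 0)"
        unfolding coeff2_sum coeff2_mono2 using a assms(2) by (intro sum.cong) auto
      then show ?thesis using a by (simp add: e_def)
    next
      case False
      then have "coeff2 ?S i j = 0"
        unfolding coeff2_sum coeff2_mono2 by (intro sum.neutral) auto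
      then show ?thesis using False supp by metis
    qed
  qed
  then have F: "F = (\<Sum>a\<le>g. const2 (e a) * U ^ (g - a) * V ^ a)"
    by (simp add: mono2_def U_def V_def power_mult)
  have "e g \<noteq> 0" "e 0 \<noteq> 0" using ends by (simp_all add: e_def mult.commute)
  \<comment> \<open>Since \<open>e g\<close> is nonzero, the polynomial has degree
    \<open>g > 0\<close> and thus a root; since \<open>e 0\<close> is nonzero, the root is not
    0.\<close>
  then obtain c where c: "(\<Sum>a\<le>g. e a * c ^ a) = 0"
    using alg_closed assms(4) by blast
  have "c \<noteq> 0"
  proof
    assume "c = 0"
    then have "(\<Sum>a\<le>g. e a * c ^ a) = (\<Sum>a\<le>g. if a = 0 then e 0 else 0)"
      by (intro sum.cong) (auto simp: power_0_left)
    then show False using c \<open>e 0 \<noteq> 0\<close> by simp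
  qed
  \<comment> \<open>The form vanishes at \<open>V = c U\<close>. Subtracting this zero turns
    \<open>F\<close> into a combination of differences of powers, each divisible by
    \<open>V - c U\<close>.\<close>
  have "(\<Sum>a\<le>g. const2 (e a) * U ^ (g - a) * (const2 c * U) ^ a)
      = (\<Sum>a\<le>g. const2 (e a * c ^ a) * U ^ g)"
  proof (rule sum.cong)
    fix a assume "a \<in> {..g}"
    then have "U ^ g = U ^ (g - a) * U ^ a" by (simp flip: power_add)
    then show "const2 (e a) * U ^ (g - a) * (const2 c * U) ^ a = const2 (e a * c ^ a) * U ^ g"
      by (simp add: const2_mult const2_power power_mult_distrib algebra_simps)
  qed simp
  also have "\<dots> = 0"
    by (simp add: c flip: sum_distrib_right const2_sum)
  finally have "F = (\<Sum>a\<le>g. const2 (e a) * U ^ (g - a) * (V ^ a - (const2 c * U) ^ a))"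
    by (simp add: F right_diff_distrib sum_subtractf)
  moreover have "V - const2 c * U dvd V ^ a - (const2 c * U) ^ a" for a
    unfolding power_diff_sumr2 by (rule dvd_triv_left)
  ultimately have "V - const2 c * U dvd F"
    by (auto intro!: dvd_sum dvd_mult)
  then show ?thesis using that \<open>c \<noteq> 0\<close> by (simp add: U_def V_def)
qed

lemma coeff2_X1_power_mult: "coeff2 (X1 ^ k * p) (k + i) j = coeff2 p i j"
  by (simp add: X1_power coeff2_def coeff_monom_mult)

lemma coeff2_X2_power_mult: "coeff2 (X2 ^ k * p) i (k + j) = coeff2 p i j"
  by (simp add: X2_power coeff2_def coeff_monom_mult)

lemma X2_dvd_X1_power_mult: "X2 dvd X1 ^ k * p \<Longrightarrow> X2 dvd p" for p :: "'a::idom poly2"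
  by (metis X2_dvd_iff coeff2_X1_power_mult)

lemma X1_dvd_X2_power_mult: "X1 dvd X2 ^ k * p \<Longrightarrow> X1 dvd p" for p :: "'a::idom poly2"
  by (metis X1_dvd_iff coeff2_X2_power_mult)

lemma of_nat_eq_const2: "of_nat n = const2 (of_nat n)"
  by (induction n) (simp_all add: const2_add)

lemma X2_dvd_const2_mult: "X2 dvd const2 c * p \<Longrightarrow> c \<noteq> 0 \<Longrightarrow> X2 dvd p" for p :: "'a::idom poly2"
  by (simp add: X2_dvd_iff coeff2_const2_mult)

lemma X1_dvd_const2_mult: "X1 dvd const2 c * p \<Longrightarrow> c \<noteq> 0 \<Longrightarrow> X1 dvd p" for p :: "'a::idom poly2"
  by (simp add: X1_dvd_iff coeff2_const2_mult)

text \<open>If both exponents were at least 2, applying \<open>jac F\<close> to the binomial would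
  show that \<open>X2\<close> divides \<open>dy F\<close> and \<open>X1\<close> divides
  \<open>dx F\<close>. Up to sign these are the derivatives of \<open>X1\<close> and
  \<open>X2\<close>, so \<open>not_mutually_dvd\<close> is violated.\<close>

lemma lnd_binomial_exponent:
  fixes F :: "'a::{idom, ring_char_0} poly2"
  assumes lnd: "lnd (jac F)" and ker: "jac F (X2 ^ p - const2 c * X1 ^ q) = 0" and "c \<noteq> 0"
    and nonconst: "dx F \<noteq> 0" and "p > 0" "q > 0"
  shows "p = 1 \<or> q = 1"
proof (rule ccontr)
  assume "\<not> ?thesis"
  then obtain k l where kl: "p = Suc (Suc k)" "q = Suc (Suc l)"
    using assms(5,6) by (metis One_nat_def not0_implies_Suc gr0_implies_Suc)
  interpret derivation "jac F" by (rule derivation_jac)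
  have const: "jac F (const2 a) = 0" for a by (simp add: jac_def)
  have p1: "p - 1 = Suc k" and q1: "q - 1 = Suc l" using kl by simp_all
  have "jac F (X2 ^ p) = const2 (of_nat p) * (X2 ^ Suc k * dx F)"
    unfolding D_power p1 jac_X2 of_nat_eq_const2[symmetric] by (simp only: mult_ac)
  moreover have "jac F (const2 c * X1 ^ q) = - (const2 (c * of_nat q) * (X1 ^ Suc l * dy F))"
    unfolding D_mult const D_power q1 jac_X1 const2_mult of_nat_eq_const2[symmetric]
    by (simp only: mult_ac mult_zero_left add_0_left mult_minus_right mult_minus_left)
  moreover note ker
  ultimately have eq: "const2 (of_nat p) * (X2 ^ Suc k * dx F)
      = const2 (- (c * of_nat q)) * (X1 ^ Suc l * dy F)"
    by (simp add: D_diff const2_minus add_eq_0_iff)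
  have nz: "of_nat p \<noteq> (0 :: 'a)" "- (c * of_nat q) \<noteq> 0"
    using assms by simp_all
  have "X2 dvd const2 (of_nat p) * (X2 ^ Suc k * dx F)" "X1 dvd const2 (- (c * of_nat q)) * (X1 ^ Suc l * dy F)"
    by simp_all
  then have dvd: "X2 dvd dy F" "X1 dvd dx F"
    using eq nz by (metis X2_dvd_const2_mult X2_dvd_X1_power_mult X1_dvd_const2_mult X1_dvd_X2_power_mult)+
  have "dy F \<noteq> 0"
    using eq nz nonconst by (auto simp: X2_def)
  with nonconst dvd not_mutually_dvd[of X1 X2] lnd show False
    by (simp add: jac_X1 jac_X2 lnd_def nilp_def)
qed

subsection \<open>The affine group\<close>

lemma mult_GA2: "mult GA2 = comp2" and one_GA2: "one GA2 = (X1, X2)"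
  by (simp_all add: GA2_def units_of_def End2_def)

lemma carrier_GA2I: "comp2 \<tau> \<sigma> = (X1, X2) \<Longrightarrow> comp2 \<sigma> \<tau> = (X1, X2) \<Longrightarrow> \<sigma> \<in> carrier GA2"
  unfolding carrier_GA2_iff by blast

lemma comp2_closed: "\<sigma> \<in> carrier GA2 \<Longrightarrow> \<tau> \<in> carrier GA2 \<Longrightarrow> comp2 \<sigma> \<tau> \<in> carrier GA2"
  using monoid.m_closed[OF group.is_monoid[OF group_GA2]] by (simp add: mult_GA2)

lemma comp2_Pair: "comp2 (f, g) (u, v) = (subst2 f u v, subst2 g u v)"
  by (simp add: comp2_def)

lemma comp2_id [simp]: "comp2 \<sigma> (X1, X2) = \<sigma>" "comp2 (X1, X2) \<sigma> = \<sigma>"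
  by (simp_all add: comp2_def)

lemma comp2_assoc: "comp2 (comp2 \<rho> \<sigma>) \<tau> = comp2 \<rho> (comp2 \<sigma> \<tau>)"
  by (simp add: comp2_def subst2_subst2)

lemma subgroup_GA2_comp2: "subgroup H GA2 \<Longrightarrow> \<sigma> \<in> H \<Longrightarrow> \<tau> \<in> H \<Longrightarrow> comp2 \<sigma> \<tau> \<in> H"
  using subgroup.m_closed[of H GA2] by (simp add: mult_GA2)

lemma subgroup_GA2_inverse:
  assumes "subgroup H GA2" "\<sigma> \<in> H" "comp2 \<tau> \<sigma> = (X1, X2)"
  shows "\<tau> \<in> H"
proof -
  interpret group GA2 by (rule group_GA2)
  have \<sigma>: "\<sigma> \<in> carrier GA2" using assms(1,2) by (rule subgroup.mem_carrier)
  obtain \<rho> where \<rho>: "comp2 \<rho> \<sigma> = (X1, X2)" "comp2 \<sigma> \<rho> = (X1, X2)"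
    using \<sigma> by (auto simp: carrier_GA2_iff)
  have "\<rho> \<in> carrier GA2" using \<rho> by (intro carrier_GA2I)
  have "\<tau> = comp2 \<tau> (comp2 \<sigma> \<rho>)" by (simp add: \<rho>)
  also have "\<dots> = comp2 (X1, X2) \<rho>" by (simp add: assms(3) flip: comp2_assoc)
  also have "\<dots> = \<rho>" by simp
  finally have "\<tau> = inv\<^bsub>GA2\<^esub> \<sigma>"
    using \<rho> \<sigma> \<open>\<rho> \<in> carrier GA2\<close> by (intro inv_equality[symmetric]) (auto simp: mult_GA2 one_GA2)
  then show ?thesis using subgroup.m_inv_closed[OF assms(1,2)] by simp
qed

lemma subgroup_GA2_cancel_right:
  assumes "subgroup H GA2" "\<tau> \<in> H" "comp2 \<sigma> \<tau> \<in> H"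
  shows "\<sigma> \<in> H"
proof -
  have "\<tau> \<in> carrier GA2" using assms(1,2) by (rule subgroup.mem_carrier)
  then obtain \<rho> where \<rho>: "comp2 \<rho> \<tau> = (X1, X2)" "comp2 \<tau> \<rho> = (X1, X2)"
    by (auto simp: carrier_GA2_iff)
  then have "\<rho> \<in> H" using subgroup_GA2_inverse assms(1,2) by blast
  then have "comp2 (comp2 \<sigma> \<tau>) \<rho> \<in> H" using assms subgroup_GA2_comp2 by blast
  then show ?thesis by (simp add: comp2_assoc \<rho>)
qed

definition aff :: "'a::comm_ring_1 \<Rightarrow> 'a \<Rightarrow> 'a \<Rightarrow> 'a \<Rightarrow> 'a \<Rightarrow> 'a \<Rightarrow> 'a end2" where
  "aff a b e c d f = (const2 a * X1 + const2 b * X2 + const2 e, const2 c * X1 + const2 d * X2 + const2 f)"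

lemma comp2_aff:
  "comp2 (aff a b e c d f) (aff a' b' e' c' d' f') =
     aff (a * a' + b * c') (a * b' + b * d') (a * e' + b * f' + e)
         (c * a' + d * c') (c * b' + d * d') (c * e' + d * f' + f)"
  by (simp add: aff_def comp2_Pair subst2_simps const2_add const2_mult algebra_simps)

lemma aff_cong:
  "\<lbrakk>a = a'; b = b'; e = e'; c = c'; d = d'; f = f'\<rbrakk> \<Longrightarrow> aff a b e c d f = aff a' b' e' c' d' f'"
  by simp

lemma aff_id: "aff 1 0 0 0 1 0 = (X1, X2)"
  by (simp add: aff_def)

lemma jac_aff: "jac (fst (aff a b e c d f)) (snd (aff a b e c d f)) = const2 (a * d - b * c)"
  by (simp add: aff_def jac_def dx_add dy_add dx_mult dy_mult const2_mult const2_diff)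

lemma aff_inverse:
  fixes a b c d e f :: "'a::field"
  assumes "a * d - b * c \<noteq> 0"
  obtains a' b' e' c' d' f' where "comp2 (aff a' b' e' c' d' f') (aff a b e c d f) = (X1, X2)"
    "comp2 (aff a b e c d f) (aff a' b' e' c' d' f') = (X1, X2)"
proof -
  define D where "D = a * d - b * c"
  have D: "D \<noteq> 0" using assms by (simp add: D_def)
  \<comment> \<open>Cramer's rule; the translation part is minus the inverse matrix applied to
    \<open>(e, f)\<close>.\<close>
  show ?thesis
    by (rule that[of "d / D" "- b / D" "(b * f - d * e) / D" "- c / D" "a / D" "(c * e - a * f) / D"];
        unfold comp2_aff aff_id[symmetric])
       (rule aff_cong; insert D; simp add: field_simps; simp add: D_def algebra_simps)+
qed

lemma deg_end2_le_iff:
  "deg_end2 \<sigma> \<le> d \<longleftrightarrow> (\<forall>i j. d < i + j \<longrightarrow> coeff2 (fst \<sigma>) i j = 0 \<and> coeff2 (snd \<sigma>) i j = 0)"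
  by (auto simp: deg_end2_def degree2_le_iff) (meson leD not_le_imp_less)+

text \<open>An automorphism cannot have degree 0, because its Jacobian is nonzero. The condition of
  degree 1 thus becomes a closed one.\<close>

lemma Aff2_eq_End2_le: "Aff2 = End2_le 1 \<inter> carrier (GA2 :: 'a::idom end2 monoid)"
proof -
  have nz: "deg_end2 \<sigma> \<noteq> 0" if \<sigma>: "\<sigma> \<in> carrier GA2" for \<sigma> :: "'a end2"
  proof
    assume "deg_end2 \<sigma> = 0"
    then have "coeff2 (fst \<sigma>) i j = 0" if "0 < i + j" for i j
      using that deg_end2_le_iff[of \<sigma> 0] by auto
    then have "dx (fst \<sigma>) = 0" "dy (fst \<sigma>) = 0"
      by (auto intro!: poly2_eqI simp: coeff2_dx coeff2_dy)
    then have "jac (fst \<sigma>) (snd \<sigma>) = 0" by (simp add: jac_def)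
    moreover obtain c where "c \<noteq> 0" "jac (fst \<sigma>) (snd \<sigma>) = const2 c"
      using \<sigma> by (rule jac_GA2)
    ultimately show False by simp
  qed
  then have "deg_end2 \<sigma> = 1 \<longleftrightarrow> deg_end2 \<sigma> \<le> 1" if "\<sigma> \<in> carrier GA2" for \<sigma> :: "'a end2"
    using nz[OF that] by linarith
  then show ?thesis by (auto simp: Aff2_def End2_le_def)
qed

lemma coeff2_const2_X1_X2:
  "coeff2 (const2 a * X1 + const2 b * X2 + const2 e) i j
     = (if i = 1 \<and> j = 0 then a else if i = 0 \<and> j = 1 then b else if i = 0 \<and> j = 0 then e else 0)"
  by (auto simp: coeff2_add coeff2_const2_mult coeff2_X1 coeff2_X2 coeff2_const2)

lemma Aff2_eq: "Aff2 = {aff a b e c d f | a b e c d f. a * d - b * c \<noteq> (0 :: 'a::field)}"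
proof (intro equalityI subsetI)
  fix \<sigma> :: "'a end2"
  assume "\<sigma> \<in> Aff2"
  then have \<sigma>: "\<sigma> \<in> carrier GA2" "deg_end2 \<sigma> \<le> 1" by (auto simp: Aff2_def)
  have lin: "p = const2 (coeff2 p 1 0) * X1 + const2 (coeff2 p 0 1) * X2 + const2 (coeff2 p 0 0)"
    if "\<forall>i j. 1 < i + j \<longrightarrow> coeff2 p i j = 0" for p :: "'a poly2"
  proof (rule poly2_eqI)
    fix i j :: nat
    consider "1 < i + j" | "i = 0" "j = 0" | "i = 1" "j = 0" | "i = 0" "j = 1"
      by atomize_elim arith
    then show "coeff2 p i j
      = coeff2 (const2 (coeff2 p 1 0) * X1 + const2 (coeff2 p 0 1) * X2 + const2 (coeff2 p 0 0)) i j"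
      unfolding coeff2_const2_X1_X2 using that by cases auto
  qed
  from lin[of "fst \<sigma>"] lin[of "snd \<sigma>"] \<sigma>(2) obtain a b e c d f where s: "\<sigma> = aff a b e c d f"
    unfolding deg_end2_le_iff aff_def prod_eq_iff by auto
  obtain k where "k \<noteq> 0" "jac (fst \<sigma>) (snd \<sigma>) = const2 k" using jac_GA2[OF \<sigma>(1)] .
  then have "a * d - b * c \<noteq> 0"
    unfolding s jac_aff by auto
  then show "\<sigma> \<in> {aff a b e c d f | a b e c d f. a * d - b * c \<noteq> 0}"
    unfolding s by blast
next
  fix \<sigma> :: "'a end2"
  assume "\<sigma> \<in> {aff a b e c d f | a b e c d f. a * d - b * c \<noteq> 0}"
  then obtain a b e c d f where s: "\<sigma> = aff a b e c d f" and det: "a * d - b * c \<noteq> 0" by blast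
  have "\<sigma> \<in> carrier GA2"
    unfolding s carrier_GA2_iff using aff_inverse[OF det] by metis
  moreover have "deg_end2 \<sigma> \<le> 1"
    unfolding deg_end2_le_iff s aff_def fst_conv snd_conv coeff2_const2_X1_X2 by auto
  ultimately show "\<sigma> \<in> Aff2" by (simp add: Aff2_eq_End2_le End2_le_def)
qed

lemma aff_mem_Aff2: "a * d - b * c \<noteq> 0 \<Longrightarrow> aff a b e c d f \<in> Aff2" for a :: "'a::field"
  unfolding Aff2_eq by blast

lemma subgroup_Aff2: "subgroup (Aff2 :: 'a::field end2 set) GA2"
proof -
  interpret group "GA2 :: 'a end2 monoid" by (rule group_GA2)
  show ?thesis
  proof (rule subgroupI)
    show "Aff2 \<subseteq> carrier GA2" by (auto simp: Aff2_def)
    have "aff 1 0 0 0 1 0 \<in> (Aff2 :: 'a end2 set)" by (rule aff_mem_Aff2) simp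
    then show "Aff2 \<noteq> ({} :: 'a end2 set)" by blast
  next
    fix \<sigma> :: "'a end2" assume "\<sigma> \<in> Aff2"
    then obtain a b e c d f where s: "\<sigma> = aff a b e c d f" and det: "a * d - b * c \<noteq> 0"
      by (auto simp: Aff2_eq)
    obtain a' b' e' c' d' f' where inv: "comp2 (aff a' b' e' c' d' f') (aff a b e c d f) = (X1, X2)"
      "comp2 (aff a b e c d f) (aff a' b' e' c' d' f') = (X1, X2)"
      using aff_inverse[OF det] by metis
    then have carrier: "aff a' b' e' c' d' f' \<in> carrier GA2" by (intro carrier_GA2I)
    then obtain k where "k \<noteq> 0"
      "jac (fst (aff a' b' e' c' d' f')) (snd (aff a' b' e' c' d' f')) = const2 k"
      by (rule jac_GA2)
    then have "aff a' b' e' c' d' f' \<in> Aff2"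
      by (intro aff_mem_Aff2) (auto simp: jac_aff)
    moreover have "inv\<^bsub>GA2\<^esub> \<sigma> = aff a' b' e' c' d' f'"
      using inv carrier \<open>\<sigma> \<in> Aff2\<close>
      by (intro inv_equality) (auto simp: mult_GA2 one_GA2 s Aff2_def)
    ultimately show "inv\<^bsub>GA2\<^esub> \<sigma> \<in> Aff2" by simp
  next
    fix \<sigma> \<tau> :: "'a end2" assume "\<sigma> \<in> Aff2" "\<tau> \<in> Aff2"
    then obtain a b e c d f a' b' e' c' d' f' where s: "\<sigma> = aff a b e c d f" "a * d - b * c \<noteq> 0"
      and t: "\<tau> = aff a' b' e' c' d' f'" "a' * d' - b' * c' \<noteq> 0"
      by (auto simp: Aff2_eq)
    have "(a * a' + b * c') * (c * b' + d * d') - (a * b' + b * d') * (c * a' + d * c')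
        = (a * d - b * c) * (a' * d' - b' * c')"
      by (simp add: algebra_simps)
    then show "\<sigma> \<otimes>\<^bsub>GA2\<^esub> \<tau> \<in> Aff2"
      unfolding mult_GA2 s t comp2_aff using s(2) t(2) by (intro aff_mem_Aff2) simp
  qed
qed

subsection \<open>Generation by affine maps and shears\<close>

text \<open>The substitution is homogeneous for the weights \<open>k\<close> and 1, so it commutes
  with taking weighted parts.\<close>

lemma grade_shear:
  "grade k 1 (subst2 f (X1 + const2 c * X2 ^ k) X2)
     = map_poly (\<lambda>p. subst2 p (X1 + const2 c * X2 ^ k) X2) (grade k 1 f)" (is "?L f = ?R f")
proof (induction f rule: poly2_mono_induct)
  case (add p q)
  then show ?case by (simp add: subst2_add grade_add map_poly_additive)
next
  case (mono i j)
  define u :: "'a poly2" where "u = X1 + const2 c * X2 ^ k"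
  have "grade k 1 u = monom X1 k + monom (const2 c) 0 * monom (X2 ^ k) k"
    by (simp add: u_def grade_add grade_mult grade_power monom_power monom_0 del: One_nat_def)
  then have u: "grade k 1 u = monom u k"
    by (simp add: mult_monom u_def add_monom del: One_nat_def)
  have "grade k 1 (const2 a * u ^ i * X2 ^ j) = monom (const2 a * u ^ i * X2 ^ j) (k * i + j)" for a
    by (simp add: grade_mult grade_power u monom_power mult_monom del: One_nat_def flip: monom_0)
  then show ?case
    by (simp add: grade_mono2 map_poly_monom subst2_mono2 flip: u_def)
qed simp

text \<open>The shear sends \<open>X2 ^ k - c X1\<close> to \<open>- c X1\<close>, so the new
  leading form has zero Jacobian with \<open>X1\<close> and no longer involves \<open>X2\<close>.
  This removes the monomial \<open>X2 ^ m\<close>.\<close>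

lemma shear_lowers:
  fixes f F :: "'a::{field, ring_char_0} poly2"
  assumes "n > 0" "k > 0" "m = k * n" "c \<noteq> 0"
    and below: "\<And>i j. coeff2 f i j \<noteq> 0 \<Longrightarrow> k * i + j \<le> m"
    and F: "\<And>i j. coeff2 F i j = (if k * i + j = m then coeff2 f i j else 0)"
    and ker: "jac F (X2 ^ k - const2 c * X1) = 0"
  shows "box n (m - 1) (subst2 f (X1 + const2 (1 / c) * X2 ^ k) X2)"
proof -
  define u :: "'a poly2" where "u = X1 + const2 (1 / c) * X2 ^ k"
  define G where "G = subst2 f u X2"
  have G: "coeff (grade k 1 G) e = subst2 (coeff (grade k 1 f) e) u X2" for e
    by (simp add: G_def u_def grade_shear coeff_map_poly del: One_nat_def)
  have "coeff (grade k 1 f) m = F"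
    by (rule poly2_eqI) (simp add: F coeff2_grade)
  then have G_m: "coeff (grade k 1 G) m = subst2 F u X2"
    by (simp only: G)
  have "const2 c * const2 (1 / c) = (1 :: 'a poly2)"
    using \<open>c \<noteq> 0\<close> by (simp flip: const2_mult)
  then have "subst2 (X2 ^ k - const2 c * X1) u X2 = const2 (- c) * X1"
    by (simp add: subst2_simps u_def distrib_left const2_minus flip: mult.assoc)
  then have "jac (subst2 F u X2) (const2 (- c) * X1) = 0"
    using jac_subst2[of F u X2 "X2 ^ k - const2 c * X1"] by (simp add: ker)
  then have dy: "dy (subst2 F u X2) = 0"
    using \<open>c \<noteq> 0\<close> by (simp add: jac_def dx_mult dy_mult)
  have *: "k * i + j \<le> m" "k * i + j = m \<Longrightarrow> j = 0" if "coeff2 G i j \<noteq> 0" for i j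
  proof -
    have nz: "coeff2 (coeff (grade k 1 G) (k * i + j)) i j \<noteq> 0"
      using that by (simp add: coeff2_grade)
    show "k * i + j \<le> m"
    proof (rule ccontr)
      assume "\<not> k * i + j \<le> m"
      then have "coeff (grade k 1 f) (k * i + j) = 0"
        using degree_grade_le[of f k 1 m] below by (intro coeff_eq_0) auto
      then show False using nz G[of "k * i + j"] by simp
    qed
    show "j = 0" if "k * i + j = m"
      using nz dy_eq_0D[OF dy, of j i] unfolding that G_m by blast
  qed
  have "i \<le> n \<and> j \<le> m - 1" if "coeff2 G i j \<noteq> 0" for i j
  proof
    have "k * i \<le> k * n" using *(1)[OF that] assms(3) by linarith
    then show "i \<le> n" using \<open>k > 0\<close> by simp
    have "m > 0" using assms by simp
    show "j \<le> m - 1"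
    proof (cases "k * i + j = m")
      case True
      then show ?thesis using *(2)[OF that] by simp
    next
      case False
      then show ?thesis using *(1)[OF that] by linarith
    qed
  qed
  then show ?thesis by (auto simp: box_def G_def u_def)
qed

section \<open>Reduction of Newton polygons by shears\<close>

abbreviation swap2 :: "'a::comm_ring_1 poly2 \<Rightarrow> 'a poly2" where
  "swap2 p \<equiv> subst2 p X2 X1"

lemma coeff2_swap2: "coeff2 (swap2 p) i j = coeff2 p j i"
proof (induction p rule: poly2_mono_induct)
  case (mono i' j')
  have "swap2 (mono2 c i' j') = mono2 c j' i'" for c :: 'a
    by (simp only: subst2_mono2) (simp add: mono2_def mult_ac)
  then show ?case by (auto simp: coeff2_mono2)
qed (simp_all add: subst2_add coeff2_add)

lemma box_swap2: "box n m (swap2 p) \<longleftrightarrow> box m n p"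
  by (auto simp: box_def coeff2_swap2)

text \<open>As both bounds of the box are attained, \<open>X2 ^ m\<close> and \<open>X1 ^ n\<close>
  occur. The edge joining them is the leading form for the weights \<open>p = m / g\<close> and
  \<open>q = n / g\<close>; it has a binomial factor with \<open>q = 1\<close> or
  \<open>p = 1\<close>, which tells which variable to shear.\<close>

lemma newton_step:
  fixes f :: "'a::{alg_closed_field, field_char_0} poly2"
  assumes lnd: "lnd (jac f)" and box: "box n m f" "n > 0" "m > 0"
    and top: "coeff2 f i0 m \<noteq> 0" and right: "coeff2 f n j0 \<noteq> 0"
  shows "(\<exists>k c. box n (m - 1) (subst2 f (X1 + const2 c * X2 ^ k) X2)) \<or>
    (\<exists>k c. box (n - 1) m (subst2 f X1 (X2 + const2 c * X1 ^ k)))"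
proof -
  have "gcd m n \<noteq> 0" using box by simp
  then obtain g p q where pq: "m = g * p" "n = g * q" "coprime p q"
    using gcd_coprime_exists[of m n] by (metis mult.commute)
  have pos: "g > 0" "p > 0" "q > 0" using box pq by (auto intro!: Nat.gr0I)
  have below: "p * i + q * j \<le> g * p * q" if "coeff2 f i j \<noteq> 0" for i j
    using lnd_below_edge[OF lnd box(1) that, of p "g * p * q" q] by (simp add: pq)
  define F where "F = coeff (grade p q f) (g * p * q)"
  have F: "coeff2 F i j = (if p * i + q * j = g * p * q then coeff2 f i j else 0)" for i j
    by (simp add: F_def coeff2_grade)
  have lndF: "lnd (jac F)"
    unfolding F_def using below by (intro lnd_leading_form[OF lnd] degree_grade_le)
  have ends: "coeff2 F 0 m \<noteq> 0" "coeff2 F n 0 \<noteq> 0"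
    using lnd_top_right[OF lnd box(1,3) top] lnd_right_top[OF lnd box(1,2) right] top right
    by (auto simp: F pq)
  then have "F \<noteq> 0" by auto
  obtain c where c: "c \<noteq> 0" "X2 ^ p - const2 c * X1 ^ q dvd F"
    using binomial_factor_of_quasihomogeneous[of p q g F] pos pq ends
    by (metis F)
  then have ker: "jac F (X2 ^ p - const2 c * X1 ^ q) = 0"
    using lnd_jac_kernel_factor[OF lndF \<open>F \<noteq> 0\<close>] by blast
  have "dx F \<noteq> 0" using dx_eq_0D[of F n 0] box ends by auto
  from lnd_binomial_exponent[OF lndF ker c(1) this pos(2,3)] show ?thesis
  proof
    assume "q = 1"
    then have "box n (m - 1) (subst2 f (X1 + const2 (1 / c) * X2 ^ p) X2)"
      using box pos c below F ker pq by (intro shear_lowers[of n p m c f F]) (auto simp: mult_ac)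
    then show ?thesis by blast
  next
    assume p: "p = 1"
    \<comment> \<open>Swapping the variables reduces to the previous case, with \<open>1 / c\<close>
      in place of \<open>c\<close>.\<close>
    have "swap2 (X2 ^ p - const2 c * X1 ^ q) = const2 (- c) * (X2 ^ q - const2 (1 / c) * X1)"
      using c(1) by (simp add: p subst2_simps right_diff_distrib const2_minus
          flip: mult.assoc const2_mult)
    then have "jac (swap2 F) (const2 (- c) * (X2 ^ q - const2 (1 / c) * X1)) = 0"
      using jac_subst2[of F X2 X1 "X2 ^ p - const2 c * X1 ^ q"] by (simp add: ker)
    moreover have "jac (swap2 F) (const2 (- c) * h) = const2 (- c) * jac (swap2 F) h" for h
      by (simp add: jac_def dx_mult dy_mult algebra_simps)
    ultimately have "jac (swap2 F) (X2 ^ q - const2 (1 / c) * X1) = 0"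
      using c(1) by simp
    then have "box m (n - 1) (subst2 (swap2 f) (X1 + const2 (1 / (1 / c)) * X2 ^ q) X2)"
      using box pos c pq p below
      by (intro shear_lowers[of m q n "1 / c" "swap2 f" "swap2 F"])
         (auto simp: coeff2_swap2 F mult_ac add_ac)
    then have "box (n - 1) m (swap2 (subst2 (swap2 f) (X1 + const2 c * X2 ^ q) X2))"
      by (simp add: box_swap2)
    then show ?thesis
      by (auto simp: subst2_subst2 subst2_simps)
  qed
qed

text \<open>
  \<open>[:p:]\<close> is \<open>p(x\<^sub>1)\<close>, so that its image under the swap of variables is \<open>p(x\<^sub>2)\<close>.
\<close>

definition shear :: "'a::comm_ring_1 poly \<Rightarrow> 'a end2" where
  "shear p = (X1 + subst2 [:p:] X2 X1, X2)"

lemma subst2_const_poly_add: "subst2 [:p + q:] u v = subst2 [:p:] u v + subst2 [:q:] u v"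
  using subst2_add[of "[:p:]" "[:q:]" u v] by simp

lemma subst2_const_poly_cong: "subst2 [:p:] u v = subst2 [:p:] u v'"
  by (simp add: subst2_def map_poly_pCons)

lemma subst2_const_poly_monom: "subst2 [:monom c k:] u v = const2 c * u ^ k"
proof -
  have "[:monom c k:] = mono2 c k 0"
    by (simp add: mono2_eq_monom monom_0)
  then show ?thesis by (simp add: subst2_mono2)
qed

lemma shear_add: "comp2 (shear p) (shear q) = shear (p + q)"
  unfolding shear_def comp2_Pair
  by (simp add: subst2_simps subst2_subst2 subst2_const_poly_add
      subst2_const_poly_cong[of p X2 "X1 + _" X1])

lemma shear_0: "shear 0 = (X1, X2)"
  by (simp add: shear_def)

lemma shear_mem_GA2: "shear p \<in> carrier GA2"
  by (rule carrier_GA2I[of "shear (- p)"]) (simp_all add: shear_add shear_0)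

lemma swap_mem_Aff2: "(X2, X1) \<in> (Aff2 :: 'a::field end2 set)"
  using aff_mem_Aff2[of 0 0 1 1 0 0] by (simp add: aff_def)

text \<open>If the first component is free of \<open>X2\<close>, the Jacobian is the product
  \<open>dx f * dy g\<close>, so both factors are constants and the automorphism is
  triangular.\<close>

lemma jung_base:
  fixes \<sigma> :: "'a::field_char_0 end2"
  assumes H: "subgroup H GA2" "Aff2 \<subseteq> H" "\<And>p. shear p \<in> H"
    and \<sigma>: "\<sigma> \<in> carrier GA2" and box: "box n 0 (fst \<sigma>)"
  shows "\<sigma> \<in> H"
proof -
  obtain f g where s: "\<sigma> = (f, g)" by fastforce
  have f0: "coeff2 f i j = 0" if "j > 0" for i j
    using box that by (auto simp: box_def s)
  then have "dy f = 0" by (intro poly2_eqI) (simp add: coeff2_dy)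
  then obtain k where "k \<noteq> 0" "dx f * dy g = const2 k"
    using jac_GA2[OF \<sigma>] by (auto simp: s jac_def)
  then have "dx f * dy g * const2 (1 / k) = 1"
    by (simp flip: const2_mult)
  then have "dx f dvd 1" "dy g dvd 1"
    by (metis dvd_triv_left mult.assoc, metis dvd_triv_left mult.assoc mult.commute)
  then obtain a b where ab: "dx f = const2 a" "dy g = const2 b" "a dvd 1" "b dvd 1"
    by (auto simp: is_unit_poly_iff const2_def)
  then have "a \<noteq> 0" "b \<noteq> 0" by auto
  have f: "f = const2 a * X1 + const2 0 * X2 + const2 (coeff2 f 0 0)"
  proof (rule poly2_eqI)
    fix i j
    have "coeff2 f i j = (if i = 1 \<and> j = 0 then a else 0)" if i: "i > 0"
    proof -
      obtain k where "i = Suc k" using i by (cases i) auto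
      then show ?thesis
        using coeff2_dx[of f k j] by (auto simp: ab coeff2_const2 simp del: of_nat_Suc split: if_splits)
    qed
    then show "coeff2 f i j = coeff2 (const2 a * X1 + const2 0 * X2 + const2 (coeff2 f 0 0)) i j"
      unfolding coeff2_const2_X1_X2 using f0[of j i] by (cases "i = 0") auto
  qed
  \<comment> \<open>The division by \<open>b\<close> compensates for the diagonal map
    \<open>A\<close>, which multiplies the second component by \<open>b\<close>.\<close>
  define r where "r = smult (1 / b) (coeff g 0)"
  have g: "g = const2 b * X2 + const2 b * [:r:]"
  proof (rule poly2_eqI)
    fix i j
    have r: "coeff2 [:r:] i j = (if j = 0 then coeff2 g i 0 / b else 0)"
      by (cases j) (simp_all add: coeff2_def r_def)
    have "coeff2 g i j = (if i = 0 \<and> j = 1 then b else 0)" if j: "j > 0"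
    proof -
      obtain k where "j = Suc k" using j by (cases j) auto
      then show ?thesis
        using coeff2_dy[of g i k] by (auto simp: ab coeff2_const2 simp del: of_nat_Suc split: if_splits)
    qed
    then show "coeff2 g i j = coeff2 (const2 b * X2 + const2 b * [:r:]) i j"
      using \<open>b \<noteq> 0\<close> unfolding coeff2_add coeff2_const2_mult coeff2_X2 r by (cases "j = 0") auto
  qed
  define e where "e = coeff2 f 0 0"
  define A where "A = aff a 0 e 0 b 0"
  have "A \<in> H"
    unfolding A_def using H(2) \<open>a \<noteq> 0\<close> \<open>b \<noteq> 0\<close> by (intro subsetD[OF H(2)] aff_mem_Aff2) simp
  moreover have "(X2, X1) \<in> H" using H(2) swap_mem_Aff2 by blast
  ultimately have "comp2 A (comp2 (X2, X1) (comp2 (shear r) (X2, X1))) \<in> H"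
    using H by (intro subgroup_GA2_comp2)
  moreover have "comp2 (X2, X1) (comp2 (shear r) (X2, X1)) = (X1, X2 + [:r:])"
    by (simp add: comp2_Pair shear_def subst2_simps subst2_subst2)
  moreover have "comp2 A (X1, X2 + [:r:])
      = (const2 a * X1 + const2 0 * X2 + const2 e, const2 b * X2 + const2 b * [:r:])"
    by (simp add: A_def aff_def comp2_Pair subst2_simps distrib_left)
  then have "comp2 A (X1, X2 + [:r:]) = \<sigma>"
    by (simp only: s f[folded e_def, symmetric] g[symmetric])
  ultimately show ?thesis by simp
qed

text \<open>Induction on the half perimeter of a box around the first component. Composing on the
  right with elements of \<open>H\<close> substitutes into that component, so the second one need
  not be followed. A side that is not attained is shortened; otherwise \<open>newton_step\<close>
  applies.\<close>

lemma jung_van_der_kulk: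
  fixes \<sigma> :: "'a::{alg_closed_field, field_char_0} end2"
  assumes H: "subgroup H GA2" "Aff2 \<subseteq> H" "\<And>p. shear p \<in> H"
    and \<sigma>: "\<sigma> \<in> carrier GA2"
  shows "\<sigma> \<in> H"
proof -
  have swap: "(X2, X1) \<in> H" using H(2) swap_mem_Aff2 by blast
  have "\<sigma> \<in> H" if "\<sigma> \<in> carrier GA2" "box n m (fst \<sigma>)" for n m \<sigma>
    using that
  proof (induction "n + m" arbitrary: n m \<sigma> rule: less_induct)
    case less
    note lnd = lnd_GA2[OF less(2)]
    have carrier: "comp2 \<sigma> \<tau> \<in> carrier GA2" if "\<tau> \<in> H" for \<tau>
      using comp2_closed[OF less(2)] subgroup.mem_carrier[OF H(1) that] .
    have reduce: "\<sigma> \<in> H" if "\<tau> \<in> H" "box n' m' (fst (comp2 \<sigma> \<tau>))" "n' + m' < n + m" for \<tau> n' m'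
      using less(1)[OF that(3) carrier[OF that(1)] that(2)] that(1) H(1)
      by (metis subgroup_GA2_cancel_right)
    consider "m = 0" | "n = 0" | "m > 0" "\<forall>i. coeff2 (fst \<sigma>) i m = 0"
      | "n > 0" "\<forall>j. coeff2 (fst \<sigma>) n j = 0"
      | i j where "n > 0" "m > 0" "coeff2 (fst \<sigma>) i m \<noteq> 0" "coeff2 (fst \<sigma>) n j \<noteq> 0"
      by blast
    then show ?case
    proof cases
      case 1
      then show ?thesis using jung_base[OF H less(2)] less(3) by blast
    next
      case 2
      then have "box m 0 (fst (comp2 \<sigma> (X2, X1)))"
        using less(3) by (simp add: comp2_def box_swap2)
      then have "comp2 \<sigma> (X2, X1) \<in> H"
        using jung_base[OF H carrier[OF swap]] by blast
      then show ?thesis using subgroup_GA2_cancel_right H(1) swap by blast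
    next
      case 3
      then have "j \<le> m - 1" if "coeff2 (fst \<sigma>) i j \<noteq> 0" for i j
        using less(3) that unfolding box_def by (metis Suc_pred' le_SucE)
      then have "box n (m - 1) (fst \<sigma>)"
        using less(3) by (simp add: box_def)
      from less(1)[OF _ less(2) this] show ?thesis using 3 by simp
    next
      case 4
      then have "i \<le> n - 1" if "coeff2 (fst \<sigma>) i j \<noteq> 0" for i j
        using less(3) that unfolding box_def by (metis Suc_pred' le_SucE)
      then have "box (n - 1) m (fst \<sigma>)"
        using less(3) by (simp add: box_def)
      from less(1)[OF _ less(2) this] show ?thesis using 4 by simp
    next
      case (5 i j)
      from newton_step[OF lnd less(3) 5(1,2,3,4)] show ?thesis
      proof (elim disjE exE)
        fix k c
        assume "box n (m - 1) (subst2 (fst \<sigma>) (X1 + const2 c * X2 ^ k) X2)"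
        then have "box n (m - 1) (fst (comp2 \<sigma> (shear (monom c k))))"
          by (simp add: comp2_def shear_def subst2_const_poly_monom)
        from reduce[OF H(3) this] show "\<sigma> \<in> H" using 5 by simp
      next
        fix k c
        assume *: "box (n - 1) m (subst2 (fst \<sigma>) X1 (X2 + const2 c * X1 ^ k))"
        define \<tau> where "\<tau> = comp2 (X2, X1) (comp2 (shear (monom c k)) (X2, X1))"
        have "\<tau> = (X1, X2 + const2 c * X1 ^ k)"
          by (simp add: \<tau>_def comp2_Pair shear_def subst2_const_poly_monom subst2_simps)
        moreover have "\<tau> \<in> H"
          unfolding \<tau>_def using H swap by (intro subgroup_GA2_comp2)
        ultimately show "\<sigma> \<in> H"
          using * 5 reduce[of \<tau> "n - 1" m] by (simp add: comp2_def)
      qed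
    qed
  qed
  moreover have "box (degree2 (fst \<sigma>)) (degree2 (fst \<sigma>)) (fst \<sigma>)"
    using degree2_le_iff[of "fst \<sigma>"] by (auto simp: box_def) (meson add_leE order_refl)+
  ultimately show ?thesis using \<sigma> by blast
qed

subsection \<open>Closed sets and order filtration\<close>

text \<open>Inside \<open>End2_le d\<close> the set is cut out by the coordinates of total degree
  above \<open>n\<close>.\<close>

lemma closedin_ind_End2_le: "closedin ind_topology (End2_le n :: 'a::idom end2 set)"
  unfolding closedin_ind_topology closedin_zariski_End2
proof (intro allI impI)
  fix d :: nat
  define S :: "('a end2 \<Rightarrow> 'a) set" where
    "S = (\<lambda>(i, j) \<sigma>. coeff2 (fst \<sigma>) i j) ` {(i, j). n < i + j \<and> i + j \<le> d}
       \<union> (\<lambda>(i, j) \<sigma>. coeff2 (snd \<sigma>) i j) ` {(i, j). n < i + j \<and> i + j \<le> d}"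
  have S: "(\<forall>p\<in>S. p \<sigma> = 0)
      \<longleftrightarrow> (\<forall>i j. n < i + j \<and> i + j \<le> d \<longrightarrow> coeff2 (fst \<sigma>) i j = 0 \<and> coeff2 (snd \<sigma>) i j = 0)" for \<sigma>
    unfolding S_def ball_Un by auto
  have "S \<subseteq> polyfun_End2 d"
    by (auto simp: S_def intro: polyfun_End2.coord1 polyfun_End2.coord2)
  moreover have "End2_le n \<inter> End2_le d = zero_locus d S"
  proof (intro equalityI subsetI)
    fix \<sigma> :: "'a end2" assume "\<sigma> \<in> zero_locus d S"
    then have d: "\<sigma> \<in> End2_le d"
      and 0: "\<And>i j. n < i + j \<Longrightarrow> i + j \<le> d \<Longrightarrow> coeff2 (fst \<sigma>) i j = 0 \<and> coeff2 (snd \<sigma>) i j = 0"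
      by (auto simp: zero_locus_def S)
    have "coeff2 (fst \<sigma>) i j = 0 \<and> coeff2 (snd \<sigma>) i j = 0" if "n < i + j" for i j
      using 0[OF that] d by (cases "i + j \<le> d") (auto simp: End2_le_def deg_end2_le_iff)
    then show "\<sigma> \<in> End2_le n \<inter> End2_le d"
      using d by (simp add: End2_le_def deg_end2_le_iff)
  next
    fix \<sigma> :: "'a end2" assume "\<sigma> \<in> End2_le n \<inter> End2_le d"
    then show "\<sigma> \<in> zero_locus d S"
      by (simp add: zero_locus_def S End2_le_def deg_end2_le_iff)
  qed
  ultimately show "\<exists>S\<subseteq>polyfun_End2 d. (End2_le n :: 'a end2 set) \<inter> End2_le d = zero_locus d S"
    by (intro exI[of _ S] conjI)
qed

lemma closedin_Aff2: "closedin GA2_topology (Aff2 :: 'a::idom end2 set)"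
  unfolding GA2_topology_def closedin_subtopology Aff2_eq_End2_le
  by (intro exI[of _ "End2_le 1"] conjI refl closedin_ind_End2_le)

lemma coeff2_poly_const2:
  "coeff2 (poly A (const2 t)) i j = poly (map_poly (\<lambda>c. coeff2 c i j) A) t"
proof (induction A)
  case (pCons c A)
  then show ?case by (simp add: coeff2_add coeff2_const2_mult map_poly_pCons)
qed simp

text \<open>The pair \<open>A\<close>, \<open>B\<close> is a curve in the endomorphisms, polynomial
  in a parameter \<open>t\<close>; its coordinates are therefore polynomials in
  \<open>t\<close>.\<close>

lemma polyfun_End2_curve:
  assumes "p \<in> polyfun_End2 d"
  obtains q where "\<And>t. p (poly A (const2 t), poly B (const2 t)) = poly q t"
proof -
  have "\<exists>q. \<forall>t. p (poly A (const2 t), poly B (const2 t)) = poly q t"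
    using assms
  proof induction
    case (const c)
    then show ?case by (intro exI[of _ "[:c:]"]) simp
  next
    case (add p q)
    then show ?case by (metis poly_add)
  next
    case (mult p q)
    then show ?case by (metis poly_mult)
  qed (auto simp: coeff2_poly_const2)
  then show ?thesis using that by blast
qed

lemma curve_in_End2_le:
  obtains d where "d \<ge> 1" "\<And>t. (poly A (const2 t), poly B (const2 t)) \<in> End2_le d"
proof -
  define m where "m A = (\<Sum>k\<le>degree A. degree2 (coeff A k))" for A :: "'a poly2 poly"
  have m: "coeff2 (poly A (const2 t)) i j = 0" if "m A < i + j" for A i j t
  proof -
    have "coeff2 (coeff A k) i j = 0" for k
    proof (cases "k \<le> degree A")
      case True
      then have "degree2 (coeff A k) \<le> m A"
        unfolding m_def by (intro member_le_sum) auto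
      then show ?thesis using that degree2_le_iff[of "coeff A k" "m A"] by fastforce
    qed (simp add: coeff_eq_0)
    then have "map_poly (\<lambda>c. coeff2 c i j) A = 0"
      by (intro poly_eqI) (simp add: coeff_map_poly)
    then show ?thesis by (simp add: coeff2_poly_const2)
  qed
  show ?thesis
    by (rule that[of "Suc (m A + m B)"]) (auto simp: End2_le_def deg_end2_le_iff m)
qed

text \<open>The curve stays in a single \<open>End2_le d\<close>. Along it each defining equation is
  a polynomial in \<open>t\<close> with infinitely many zeros, so it also vanishes at 0.\<close>

lemma closed_curve_limit:
  fixes A B :: "'a::{idom, ring_char_0} poly2 poly"
  assumes closed: "closedin GA2_topology H"
    and curve: "\<And>t. t \<noteq> 0 \<Longrightarrow> (poly A (const2 t), poly B (const2 t)) \<in> H"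
    and limit: "(poly A 0, poly B 0) \<in> carrier GA2"
  shows "(poly A 0, poly B 0) \<in> H"
proof -
  obtain T where T: "closedin ind_topology T" "H = T \<inter> carrier GA2"
    using closed by (auto simp: GA2_topology_def closedin_subtopology)
  obtain d where d: "d \<ge> 1" "\<And>t. (poly A (const2 t), poly B (const2 t)) \<in> End2_le d"
    using curve_in_End2_le[where A = A and B = B] by blast
  obtain S where S: "S \<subseteq> polyfun_End2 d" "T \<inter> End2_le d = zero_locus d S"
    using T(1) d(1) by (auto simp: closedin_ind_topology closedin_zariski_End2)
  have "p (poly A 0, poly B 0) = 0" if "p \<in> S" for p
  proof -
    have "p \<in> polyfun_End2 d" using that S(1) by blast
    then obtain q where q: "\<And>t. p (poly A (const2 t), poly B (const2 t)) = poly q t"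
      using polyfun_End2_curve[where A = A and B = B] by blast
    have "poly q t = 0" if "t \<noteq> 0" for t
    proof -
      have "(poly A (const2 t), poly B (const2 t)) \<in> zero_locus d S"
        using curve[OF that] d(2) T(2) S(2) by blast
      then have "p (poly A (const2 t), poly B (const2 t)) = 0"
        using \<open>p \<in> S\<close> by (simp add: zero_locus_def)
      then show ?thesis by (simp only: q)
    qed
    then have "UNIV - {0} \<subseteq> {t. poly q t = 0}" by auto
    moreover have "infinite (UNIV - {0 :: 'a})"
      using infinite_UNIV_char_0 by (rule infinite_remove)
    ultimately have "q = 0"
      using poly_roots_finite finite_subset by blast
    then show ?thesis using q[of 0] by simp
  qed
  then have "(poly A 0, poly B 0) \<in> zero_locus d S"
    using d(2)[of 0] by (simp add: zero_locus_def)
  then show ?thesis using S(2) T(2) limit by blast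
qed

text \<open>Membership in the \<open>d\<close>-th power of the ideal generated by \<open>X1\<close>
  and \<open>X2\<close>.\<close>

definition ord_ge :: "nat \<Rightarrow> 'a::zero poly2 \<Rightarrow> bool" where
  "ord_ge d p \<longleftrightarrow> (\<forall>i j. i + j < d \<longrightarrow> coeff2 p i j = 0)"

lemma ord_ge_0 [simp]: "ord_ge d 0" "ord_ge 0 p"
  by (simp_all add: ord_ge_def)

lemma ord_ge_mono: "ord_ge d p \<Longrightarrow> e \<le> d \<Longrightarrow> ord_ge e p"
  by (auto simp: ord_ge_def)

lemma ord_ge_add: "ord_ge d p \<Longrightarrow> ord_ge d q \<Longrightarrow> ord_ge d (p + q)"
  by (simp add: ord_ge_def coeff2_add)

lemma ord_ge_diff: "ord_ge d p \<Longrightarrow> ord_ge d q \<Longrightarrow> ord_ge d (p - q)"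
  for p :: "'a::ab_group_add poly2"
  by (simp add: ord_ge_def coeff2_diff)

lemma ord_ge_const2_mult: "ord_ge d p \<Longrightarrow> ord_ge d (const2 c * p)"
  by (simp add: ord_ge_def coeff2_const2_mult)

lemma ord_ge_iff_grade: "ord_ge d p \<longleftrightarrow> (\<forall>e<d. coeff (grade 1 1 p) e = 0)"
proof
  assume "ord_ge d p"
  then show "\<forall>e<d. coeff (grade 1 1 p) e = 0"
    by (auto intro!: poly2_eqI simp: coeff2_grade ord_ge_def)
next
  assume *: "\<forall>e<d. coeff (grade 1 1 p) e = 0"
  have "coeff2 p i j = coeff2 (coeff (grade 1 1 p) (i + j)) i j" for i j
    by (simp add: coeff2_grade)
  with * show "ord_ge d p" by (simp add: ord_ge_def)
qed

lemma ord_ge_mult: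
  fixes p q :: "'a::comm_ring_1 poly2"
  assumes "ord_ge d p" "ord_ge e q"
  shows "ord_ge (d + e) (p * q)"
  unfolding ord_ge_iff_grade grade_mult coeff_mult
proof (intro allI impI sum.neutral ballI)
  fix n k assume "n < d + e" "k \<in> {..n}"
  then have "k < d \<or> n - k < e" by auto
  then show "coeff (grade 1 1 p) k * coeff (grade 1 1 q) (n - k) = 0"
    using assms by (auto simp: ord_ge_iff_grade)
qed

lemma ord_ge_X1: "ord_ge 1 X1" and ord_ge_X2: "ord_ge 1 X2"
  by (simp_all add: ord_ge_def coeff2_X1 coeff2_X2)

lemma ord_ge_power: "ord_ge 1 p \<Longrightarrow> ord_ge n (p ^ n)" for p :: "'a::comm_ring_1 poly2"
  using ord_ge_mult[of 1 p] by (induction n) auto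

lemma ord_ge_subst2:
  fixes p :: "'a::comm_ring_1 poly2"
  assumes "ord_ge d p" "ord_ge 1 u" "ord_ge 1 v"
  shows "ord_ge d (subst2 p u v)"
proof (induction p rule: poly2_mono_induct)
  case (mono i j)
  then have "d \<le> i + j" using assms(1) by (auto simp: ord_ge_def not_le[symmetric])
  moreover have "ord_ge (i + j) (subst2 (mono2 (coeff2 p i j) i j) u v)"
    unfolding subst2_mono2 mult.assoc
    by (intro ord_ge_const2_mult ord_ge_mult ord_ge_power assms)
  ultimately show ?case using ord_ge_mono by blast
qed (simp_all add: subst2_add ord_ge_add)

lemma ord_ge_power_diff:
  fixes u x :: "'a::comm_ring_1 poly2"
  assumes "ord_ge 1 x" "ord_ge 2 (u - x)"
  shows "ord_ge (Suc n) (u ^ n - x ^ n)"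
proof (induction n)
  case (Suc n)
  have "ord_ge 1 (u - x + x)"
    using assms ord_ge_mono[OF assms(2), of 1] by (intro ord_ge_add) auto
  then have "ord_ge (1 + Suc n) (u * (u ^ n - x ^ n))" using Suc by (intro ord_ge_mult) auto
  moreover have "ord_ge (2 + n) ((u - x) * x ^ n)"
    using assms by (intro ord_ge_mult ord_ge_power)
  moreover have "u ^ Suc n - x ^ Suc n = u * (u ^ n - x ^ n) + (u - x) * x ^ n"
    by (simp add: algebra_simps)
  ultimately show ?case using ord_ge_add by fastforce
qed (simp add: ord_ge_def)

text \<open>For a monomial the difference splits into \<open>u ^ i * (v ^ j - X2 ^ j)\<close> and
  \<open>(u ^ i - X1 ^ i) * X2 ^ j\<close>, and each difference of powers gains one order.\<close>

lemma ord_ge_subst2_diff: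
  assumes "ord_ge d p" "ord_ge 2 (u - X1)" "ord_ge 2 (v - X2)"
  shows "ord_ge (Suc d) (subst2 p u v - p)"
proof (induction p rule: poly2_mono_induct)
  case (add p q)
  have "subst2 (p + q) u v - (p + q) = (subst2 p u v - p) + (subst2 q u v - q)"
    by (simp add: subst2_add)
  then show ?case using add ord_ge_add by metis
next
  case (mono i j)
  then have "d \<le> i + j" using assms(1) by (auto simp: ord_ge_def not_le[symmetric])
  have "ord_ge 1 (u - X1 + X1)"
    using ord_ge_mono[OF assms(2), of 1] by (intro ord_ge_add ord_ge_X1) auto
  then have "ord_ge (i + Suc j) (u ^ i * (v ^ j - X2 ^ j))"
    using assms by (intro ord_ge_mult ord_ge_power ord_ge_power_diff ord_ge_X2) auto
  moreover have "ord_ge (Suc i + j) ((u ^ i - X1 ^ i) * X2 ^ j)"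
    using assms by (intro ord_ge_mult ord_ge_power ord_ge_power_diff ord_ge_X1 ord_ge_X2)
  ultimately have "ord_ge (Suc (i + j))
      (const2 (coeff2 p i j) * (u ^ i * (v ^ j - X2 ^ j) + (u ^ i - X1 ^ i) * X2 ^ j))"
    by (intro ord_ge_const2_mult ord_ge_add) auto
  moreover have "subst2 (mono2 (coeff2 p i j) i j) u v - mono2 (coeff2 p i j) i j
      = const2 (coeff2 p i j) * (u ^ i * (v ^ j - X2 ^ j) + (u ^ i - X1 ^ i) * X2 ^ j)"
    by (simp only: subst2_mono2) (simp add: mono2_def algebra_simps)
  ultimately show ?case
    using \<open>d \<le> i + j\<close> ord_ge_mono[of "Suc (i + j)" _ "Suc d"] by simp
qed simp

subsection \<open>Closed overgroups of the affine group\<close>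

lemma poly_grade_const2:
  "poly (grade a b f) (const2 t) = subst2 f (const2 (t ^ a) * X1) (const2 (t ^ b) * X2)"
proof (induction f rule: poly2_mono_induct)
  case (mono i j)
  have "poly (grade a b (mono2 c i j)) (const2 t)
      = subst2 (mono2 c i j) (const2 (t ^ a) * X1) (const2 (t ^ b) * X2)" for c
    by (simp only: grade_mono2 poly_monom subst2_mono2)
       (simp add: mono2_def const2_power power_mult_distrib power_add power_mult mult_ac)
  then show ?case .
qed (simp_all add: grade_add subst2_add)

text \<open>Here \<open>poly_shift d\<close> acts as division by the \<open>d\<close>-th power of
  the grading variable, which gives a quotient defined at 0.\<close>

lemma grade_eq_monom_mult:
  assumes "\<And>i j. a * i + b * j < d \<Longrightarrow> coeff2 f i j = 0"
  shows "grade a b f = monom 1 d * poly_shift d (grade a b f)"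
proof (rule poly_eqI)
  fix e
  have "coeff (grade a b f) e = 0" if "e < d"
    using assms that by (intro poly2_eqI) (auto simp: coeff2_grade)
  then show "coeff (grade a b f) e = coeff (monom 1 d * poly_shift d (grade a b f)) e"
    by (simp add: coeff_monom_mult coeff_poly_shift)
qed

text \<open>
  Conjugation by \<open>(t\<^sup>d x\<^sub>1, t x\<^sub>2)\<close> extends to \<open>t = 0\<close> and keeps there only the term \<open>x\<^sub>2\<^sup>d\<close>
  of the first component.
\<close>

lemma degeneration:
  fixes \<sigma> :: "'a::field_char_0 end2"
  assumes H: "subgroup H GA2" "closedin GA2_topology H" "Aff2 \<subseteq> H" and \<sigma>: "\<sigma> \<in> H"
    and d: "d \<ge> 2" and f: "ord_ge d (fst \<sigma> - X1)" and g: "ord_ge d (snd \<sigma> - X2)"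
  shows "shear (monom (coeff2 (fst \<sigma> - X1) 0 d) d) \<in> H"
proof -
  define f' where "f' = fst \<sigma> - X1"
  define g' where "g' = snd \<sigma> - X2"
  define A where "A = poly_shift d (grade d 1 f')"
  define B where "B = poly_shift d (grade d 1 g')"
  \<comment> \<open>A monomial of weight below \<open>d\<close> is free of \<open>X1\<close>, so its
    weight is its total degree.\<close>
  have weight: "i + j < d" if "d * i + 1 * j < d" for i j
    using that by (cases i) auto
  have A: "grade d 1 f' = monom 1 d * A" and B: "grade d 1 g' = monom 1 d * B"
    unfolding A_def B_def using f g weight
    by (auto intro!: grade_eq_monom_mult simp: ord_ge_def f'_def g'_def)
  \<comment> \<open>The outer map divides the first component by \<open>t ^ d\<close>, the second
    only by \<open>t\<close>. The remaining factor \<open>t ^ (d - 1)\<close> kills the second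
    perturbation at 0.\<close>
  have curve: "(poly ([:X1:] + A) (const2 t), poly ([:X2:] + monom 1 (d - 1) * B) (const2 t)) \<in> H"
    if t: "t \<noteq> 0" for t
  proof -
    define u where "u = const2 (t ^ d) * X1"
    define v where "v = const2 (t ^ 1) * X2"
    have "aff (t ^ d) 0 0 0 t 0 \<in> H" "aff (1 / t ^ d) 0 0 0 (1 / t) 0 \<in> H"
      using t by (auto intro!: subsetD[OF H(3)] aff_mem_Aff2)
    then have *: "comp2 (aff (1 / t ^ d) 0 0 0 (1 / t) 0) (comp2 \<sigma> (aff (t ^ d) 0 0 0 t 0)) \<in> H"
      using H(1) \<sigma> by (intro subgroup_GA2_comp2)
    have s: "fst \<sigma> = X1 + f'" "snd \<sigma> = X2 + g'" by (simp_all add: f'_def g'_def)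
    have uv: "aff (t ^ d) 0 0 0 t 0 = (u, v)"
      by (simp add: aff_def u_def v_def)
    have shift: "subst2 f' u v = const2 (t ^ d) * poly A (const2 t)"
      "subst2 g' u v = const2 (t ^ d) * poly B (const2 t)"
      unfolding u_def v_def poly_grade_const2[symmetric] A B
      by (simp_all add: poly_monom const2_power)
    have 1: "const2 (1 / t ^ d) * const2 (t ^ d) = (1 :: 'a poly2)"
      "const2 (1 / t) * const2 (t ^ d) = const2 (t ^ (d - 1))"
      "const2 (1 / t) * const2 t = (1 :: 'a poly2)"
      using t d by (simp_all add: power_diff flip: const2_mult)
    have "comp2 (aff (1 / t ^ d) 0 0 0 (1 / t) 0) (comp2 \<sigma> (u, v))
      = (const2 (1 / t ^ d) * const2 (t ^ d) * X1 + const2 (1 / t ^ d) * const2 (t ^ d) * poly A (const2 t),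
         const2 (1 / t) * const2 t * X2 + const2 (1 / t) * const2 (t ^ d) * poly B (const2 t))"
      by (simp add: aff_def comp2_def s subst2_simps shift distrib_left mult.assoc)
         (simp add: u_def v_def)
    also have "\<dots> = (poly ([:X1:] + A) (const2 t), poly ([:X2:] + monom 1 (d - 1) * B) (const2 t))"
      unfolding 1 by (simp add: poly_monom const2_power)
    finally show ?thesis using * by (simp add: uv)
  qed
  \<comment> \<open>The monomials of weight \<open>d\<close> are \<open>X2 ^ d\<close> and
    \<open>X1\<close>; the latter is excluded because the order is at least 2.\<close>
  have "coeff A 0 = const2 (coeff2 f' 0 d) * X2 ^ d"
  proof (rule poly2_eqI)
    fix i j
    have "coeff2 (const2 (coeff2 f' 0 d) * X2 ^ d) i j = (if i = 0 \<and> j = d then coeff2 f' 0 d else 0)"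
      using coeff2_mono2[of "coeff2 f' 0 d" 0 d i j] by (simp add: mono2_def)
    moreover have "coeff2 f' i j = 0" if "d * i + j = d" "\<not> (i = 0 \<and> j = d)"
    proof -
      have "i = 1 \<and> j = 0" using that d by (cases i) auto
      then show ?thesis using f d by (auto simp: ord_ge_def f'_def)
    qed
    ultimately show "coeff2 (coeff A 0) i j = coeff2 (const2 (coeff2 f' 0 d) * X2 ^ d) i j"
      by (auto simp: A_def coeff_poly_shift coeff2_grade)
  qed
  then have limit: "(poly ([:X1:] + A) 0, poly ([:X2:] + monom 1 (d - 1) * B) 0)
      = shear (monom (coeff2 f' 0 d) d)"
    using d by (simp add: shear_def poly_0_coeff_0 subst2_const_poly_monom coeff_monom_mult)
  then have "(poly ([:X1:] + A) 0, poly ([:X2:] + monom 1 (d - 1) * B) 0) \<in> H"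
    by (intro closed_curve_limit[OF H(2)]) (use curve in blast, simp only: limit shear_mem_GA2)
  then show ?thesis by (simp only: limit f'_def)
qed

text \<open>The coefficient of \<open>X2 ^ d\<close> can be read off on the line
  \<open>X1 = 0\<close>; the sum is the homogeneous part of degree \<open>d\<close> evaluated at
  \<open>(a, 1)\<close>.\<close>

lemma coeff2_subst2_shear:
  "coeff2 (subst2 p (X1 + const2 a * X2) X2) 0 d = (\<Sum>i\<le>d. coeff2 p i (d - i) * a ^ i)"
proof -
  have restrict: "coeff2 q 0 d = coeff2 (subst2 q 0 X2) 0 d" for q :: "'a poly2"
  proof (induction q rule: poly2_mono_induct)
    case (mono i j)
    have "coeff2 (mono2 c i j) 0 d = coeff2 (subst2 (mono2 c i j) 0 X2) 0 d" for c
    proof (cases i)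
      case 0
      have "subst2 (mono2 c i j) 0 X2 = mono2 c i j"
        by (simp only: subst2_mono2) (simp add: mono2_def 0)
      then show ?thesis by simp
    next
      case (Suc k)
      then show ?thesis by (simp add: subst2_mono2 coeff2_mono2)
    qed
    then show ?case .
  qed (simp_all add: subst2_add coeff2_add)
  have "coeff2 (subst2 p (const2 a * X2) X2) 0 d = (\<Sum>i\<le>d. coeff2 p i (d - i) * a ^ i)"
  proof (induction p rule: poly2_mono_induct)
    case (add p q)
    then show ?case by (simp add: subst2_add coeff2_add distrib_right sum.distrib)
  next
    case (mono k l)
    have "coeff2 (subst2 (mono2 c k l) (const2 a * X2) X2) 0 d
        = (\<Sum>i\<le>d. coeff2 (mono2 c k l) i (d - i) * a ^ i)" for c
    proof -
      have "subst2 (mono2 c k l) (const2 a * X2) X2 = mono2 (c * a ^ k) 0 (k + l)"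
        by (simp only: subst2_mono2)
           (simp add: mono2_def power_mult_distrib const2_mult const2_power power_add mult_ac)
      moreover have "(\<Sum>i\<le>d. coeff2 (mono2 c k l) i (d - i) * a ^ i)
          = (\<Sum>i\<le>d. if i = k then (if k + l = d then c * a ^ k else 0) else 0)"
        unfolding coeff2_mono2 by (intro sum.cong) auto
      ultimately show ?thesis by (auto simp: coeff2_mono2)
    qed
    then show ?case .
  qed simp
  then show ?thesis
    using restrict[of "subst2 p (X1 + const2 a * X2) X2"] by (simp add: subst2_subst2 subst2_simps)
qed

text \<open>
  If no conjugate by a linear shear contained \<open>x\<^sub>2\<^sup>d\<close>, the lowest-order part would be a multiple
  of the Euler field \<open>(x\<^sub>1, x\<^sub>2)\<close>, which is not divergence free.
\<close>

lemma lowest_order_shear: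
  fixes \<sigma> :: "'a::field_char_0 end2"
  assumes \<sigma>: "\<sigma> \<in> carrier GA2" and d: "d \<ge> 2"
    and f: "ord_ge d (fst \<sigma> - X1)" and g: "ord_ge d (snd \<sigma> - X2)"
    and zero: "\<And>a. (\<Sum>i\<le>d. coeff2 (fst \<sigma> - X1) i (d - i) * a ^ i)
      = a * (\<Sum>i\<le>d. coeff2 (snd \<sigma> - X2) i (d - i) * a ^ i)"
  shows "ord_ge (Suc d) (fst \<sigma> - X1) \<and> ord_ge (Suc d) (snd \<sigma> - X2)"
proof -
  define p where "p = fst \<sigma> - X1"
  define q where "q = snd \<sigma> - X2"
  have s: "fst \<sigma> = X1 + p" "snd \<sigma> = X2 + q" by (simp_all add: p_def q_def)
  define P where "P = (\<Sum>i\<le>d. monom (coeff2 p i (d - i)) i)"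
  define Q where "Q = (\<Sum>i\<le>d. monom (coeff2 q i (d - i)) i)"
  have "poly P a = poly (pCons 0 Q) a" for a
    using zero[of a] by (simp add: P_def Q_def p_def q_def poly_sum poly_monom)
  then have PQ: "P = pCons 0 Q" by (metis poly_eq_poly_eq_iff ext)
  have coeff_P: "coeff P i = (if i \<le> d then coeff2 p i (d - i) else 0)" for i
    by (simp add: P_def coeff_sum)
  have coeff_Q: "coeff Q i = (if i \<le> d then coeff2 q i (d - i) else 0)" for i
    by (simp add: Q_def coeff_sum)
  \<comment> \<open>Comparing coefficients in \<open>PQ\<close>: the parts of degree
    \<open>d\<close> of \<open>p\<close> and \<open>q\<close> are \<open>X1 * h\<close> and
    \<open>X2 * h\<close> for one form \<open>h\<close> of degree \<open>d - 1\<close>.\<close>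
  have p0: "coeff2 p 0 d = 0"
    using coeff_P[of 0] by (simp add: PQ)
  have q0: "coeff2 q d 0 = 0"
    using coeff_P[of "Suc d"] coeff_Q[of d] by (simp add: PQ)
  have pq: "coeff2 p (Suc i) j = coeff2 q i (Suc j)" if "i + j = d - 1" for i j
  proof -
    have "Suc i \<le> d" "d - Suc i = j" "d - i = Suc j" using that d by auto
    then show ?thesis using coeff_P[of "Suc i"] coeff_Q[of i] by (simp add: PQ)
  qed
  obtain k where "jac (fst \<sigma>) (snd \<sigma>) = const2 k" using jac_GA2[OF \<sigma>] .
  then have jac: "dx p + dy q + (dx p * dy q - dy p * dx q) = const2 k - 1"
    by (simp add: jac_def s dx_add dy_add algebra_simps)
  have "ord_ge (d - 1) (dx p)" "ord_ge (d - 1) (dy p)" "ord_ge (d - 1) (dx q)" "ord_ge (d - 1) (dy q)"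
    using f g by (simp_all add: ord_ge_def p_def q_def coeff2_dx coeff2_dy)
  then have prod: "ord_ge (d - 1 + (d - 1)) (dx p * dy q - dy p * dx q)"
    by (intro ord_ge_diff ord_ge_mult)
  \<comment> \<open>The quadratic terms of the Jacobian have order at least
    \<open>2 * (d - 1)\<close>, so in degree \<open>d - 1\<close> only the divergence remains. It
    equals \<open>d + 1\<close> times \<open>h\<close> and must vanish, as the Jacobian is
    constant.\<close>
  have q_zero: "coeff2 q i (Suc j) = 0" if ij: "i + j = d - 1" for i j
  proof -
    have "coeff2 (dx p * dy q - dy p * dx q) i j = 0"
      using prod ij d by (simp add: ord_ge_def)
    moreover have "coeff2 (const2 k - 1) i j = 0"
      using ij d by (auto simp: coeff2_diff coeff2_const2 coeff2_1)
    ultimately have "coeff2 (dx p + dy q) i j = 0"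
      using arg_cong[OF jac, of "\<lambda>r. coeff2 r i j"] by (simp add: coeff2_add)
    then have "of_nat (Suc i + Suc j) * coeff2 q i (Suc j) = 0"
      unfolding coeff2_add coeff2_dx coeff2_dy pq[OF ij] by (simp only: of_nat_add distrib_right)
    then show ?thesis by (simp del: of_nat_Suc of_nat_add)
  qed
  have "coeff2 p i j = 0" if "i + j = d" for i j
    using that p0 pq[of "i - 1" j] q_zero[of "i - 1" j] d by (cases i) auto
  moreover have "coeff2 q i j = 0" if "i + j = d" for i j
    using that q0 q_zero[of i "j - 1"] d by (cases j) auto
  ultimately show ?thesis
    using f g by (simp add: ord_ge_def less_Suc_eq p_def q_def)
qed

text \<open>Let \<open>d\<close> be the exact order of the difference from the identity. By
  \<open>lowest_order_shear\<close> conjugation with some linear shear makes the coefficient of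
  \<open>X2 ^ d\<close> in the first component nonzero, and \<open>degeneration\<close> isolates
  it.\<close>

lemma exists_monomial_shear:
  fixes \<sigma> :: "'a::field_char_0 end2"
  assumes H: "subgroup H GA2" "closedin GA2_topology H" "Aff2 \<subseteq> H" and \<sigma>: "\<sigma> \<in> H"
    and e: "e \<ge> 2" "ord_ge e (fst \<sigma> - X1)" "ord_ge e (snd \<sigma> - X2)" and "\<sigma> \<noteq> (X1, X2)"
  shows "\<exists>d c. e \<le> d \<and> c \<noteq> 0 \<and> shear (monom c d) \<in> H"
proof -
  define N where "N = {d. ord_ge d (fst \<sigma> - X1) \<and> ord_ge d (snd \<sigma> - X2)}"
  have "fst \<sigma> - X1 \<noteq> 0 \<or> snd \<sigma> - X2 \<noteq> 0"
    using \<open>\<sigma> \<noteq> (X1, X2)\<close> by (simp add: prod_eq_iff)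
  then obtain i j where "coeff2 (fst \<sigma> - X1) i j \<noteq> 0 \<or> coeff2 (snd \<sigma> - X2) i j \<noteq> 0"
    using poly2_eqI[of _ 0] by (metis coeff2_0)
  then have "n \<le> i + j" if "n \<in> N" for n
    using that by (auto simp: N_def ord_ge_def not_le[symmetric])
  then have fin: "finite N" by (meson finite_nat_set_iff_bounded_le)
  define d where "d = Max N"
  have "e \<in> N" using e by (simp add: N_def)
  then have "N \<noteq> {}" by blast
  have "d \<in> N" "e \<le> d"
    unfolding d_def using Max_in[OF fin \<open>N \<noteq> {}\<close>] Max_ge[OF fin \<open>e \<in> N\<close>] by simp_all
  have "Suc d \<notin> N"
    using Max_ge[OF fin, of "Suc d"] by (auto simp: d_def)
  from \<open>d \<in> N\<close> \<open>e \<le> d\<close> have d: "d \<ge> 2" "ord_ge d (fst \<sigma> - X1)" "ord_ge d (snd \<sigma> - X2)"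
    using e(1) by (auto simp: N_def)
  have "\<sigma> \<in> carrier GA2" using subgroup.mem_carrier[OF H(1) \<sigma>] .
  from lowest_order_shear[OF this d] \<open>Suc d \<notin> N\<close>
  obtain a where a: "(\<Sum>i\<le>d. coeff2 (fst \<sigma> - X1) i (d - i) * a ^ i)
      \<noteq> a * (\<Sum>i\<le>d. coeff2 (snd \<sigma> - X2) i (d - i) * a ^ i)"
    by (auto simp: N_def)
  define u where "u = X1 + const2 a * X2"
  define \<tau> where "\<tau> = comp2 (aff 1 (- a) 0 0 1 0) (comp2 \<sigma> (aff 1 a 0 0 1 0))"
  have "\<tau> \<in> H"
    unfolding \<tau>_def using H(1) \<sigma> by (intro subgroup_GA2_comp2) (auto intro!: subsetD[OF H(3)] aff_mem_Aff2)
  define p where "p = fst \<sigma> - X1"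
  define q where "q = snd \<sigma> - X2"
  have s: "fst \<sigma> = X1 + p" "snd \<sigma> = X2 + q" by (simp_all add: p_def q_def)
  have \<tau>: "fst \<tau> - X1 = subst2 p u X2 - const2 a * subst2 q u X2"
    "snd \<tau> - X2 = subst2 q u X2"
    by (simp_all add: \<tau>_def aff_def comp2_def s subst2_simps const2_minus u_def algebra_simps)
  have "ord_ge 1 u"
    unfolding u_def by (intro ord_ge_add ord_ge_const2_mult ord_ge_X1 ord_ge_X2)
  then have "ord_ge d (fst \<tau> - X1)" "ord_ge d (snd \<tau> - X2)"
    unfolding \<tau> p_def q_def
    by (intro ord_ge_diff ord_ge_const2_mult ord_ge_subst2 d ord_ge_X2; assumption)+
  from degeneration[OF H \<open>\<tau> \<in> H\<close> d(1) this]
  have "shear (monom (coeff2 (fst \<tau> - X1) 0 d) d) \<in> H" .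
  moreover have "coeff2 (fst \<tau> - X1) 0 d \<noteq> 0"
    using a unfolding \<tau> coeff2_diff coeff2_const2_mult u_def coeff2_subst2_shear p_def q_def
    by simp
  ultimately show ?thesis using \<open>e \<le> d\<close> by blast
qed

section \<open>Commutators of opposite shears\<close>

definition near_id :: "nat \<Rightarrow> 'a::comm_ring_1 poly2 \<Rightarrow> 'a poly2 \<Rightarrow> 'a end2 \<Rightarrow> bool" where
  "near_id d F G \<sigma> \<longleftrightarrow> ord_ge (Suc d) (fst \<sigma> - X1 - F) \<and> ord_ge (Suc d) (snd \<sigma> - X2 - G)"

text \<open>Substituting \<open>\<tau>\<close>, which is the identity up to order 2, into the order
  \<open>d\<close> terms of \<open>\<sigma>\<close> changes them only in order \<open>d + 1\<close>.
  So leading perturbations simply add up.\<close>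

lemma near_id_comp2:
  assumes "d \<ge> 2" "near_id d F G \<sigma>" "near_id d F' G' \<tau>"
    and ord: "ord_ge d F" "ord_ge d G" "ord_ge d F'" "ord_ge d G'"
  shows "near_id d (F + F') (G + G') (comp2 \<sigma> \<tau>)"
proof -
  have ord2: "ord_ge k (p - x)" if "ord_ge (Suc d) (p - x - F)" "ord_ge d F" "k \<le> d" for k p x and F :: "'a poly2"
  proof -
    have "ord_ge k (p - x - F)" "ord_ge k F"
      using that ord_ge_mono by (metis le_SucI, metis)
    then have "ord_ge k ((p - x - F) + F)" by (rule ord_ge_add)
    then show ?thesis by simp
  qed
  have \<tau>: "ord_ge 2 (fst \<tau> - X1)" "ord_ge 2 (snd \<tau> - X2)"
    using assms ord2 by (auto simp: near_id_def)
  have *: "ord_ge (Suc d) (subst2 s (fst \<tau>) (snd \<tau>) - x - (F + F'))"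
    if "ord_ge (Suc d) (s - x - F)" "ord_ge d F" "ord_ge (Suc d) (subst2 x (fst \<tau>) (snd \<tau>) - x - F')"
    for s x F F' :: "'a poly2"
  proof -
    have "ord_ge (Suc d) (subst2 (s - x) (fst \<tau>) (snd \<tau>) - (s - x))"
      using that ord2 \<tau> by (intro ord_ge_subst2_diff) auto
    then have "ord_ge (Suc d) ((subst2 (s - x) (fst \<tau>) (snd \<tau>) - (s - x)) + (s - x - F)
        + (subst2 x (fst \<tau>) (snd \<tau>) - x - F'))"
      using that by (intro ord_ge_add)
    then show ?thesis by (simp add: subst2_diff algebra_simps)
  qed
  show ?thesis
    using assms(2,3) ord by (auto simp: near_id_def comp2_def intro!: *)
qed

lemma near_id_add: "near_id d F G (X1 + F, X2 + G)"
  by (simp add: near_id_def)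

lemma swap_shear_monom:
  "comp2 (X2, X1) (comp2 (shear (monom c d)) (X2, X1)) = (X1, X2 + const2 c * X1 ^ d)"
  by (simp add: comp2_Pair shear_def subst2_const_poly_monom subst2_simps)

text \<open>Conjugation by the scaling of \<open>X1\<close> by \<open>a\<close>; for
  \<open>a = 0\<close> the result is the identity.\<close>

lemma scale_shear:
  fixes a :: "'a::field"
  assumes H: "subgroup H GA2" "Aff2 \<subseteq> H" and "shear p \<in> H"
  shows "shear (smult a p) \<in> H"
proof (cases "a = 0")
  case True
  have "(X1, X2) \<in> H" using subgroup.one_closed[OF H(1)] by (simp add: one_GA2)
  then show ?thesis using True by (simp add: shear_0)
next
  case False
  have "aff a 0 0 0 1 0 \<in> H" "aff (1 / a) 0 0 0 1 0 \<in> H"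
    using False by (auto intro!: subsetD[OF H(2)] aff_mem_Aff2)
  then have "comp2 (aff a 0 0 0 1 0) (comp2 (shear p) (aff (1 / a) 0 0 0 1 0)) \<in> H"
    using H assms(3) by (intro subgroup_GA2_comp2)
  moreover have "const2 a * const2 (1 / a) = (1 :: 'a poly2)"
    using False by (simp flip: const2_mult)
  moreover have "subst2 [:smult a p:] X2 X1 = const2 a * subst2 [:p:] X2 X1"
  proof -
    have "[:smult a p:] = const2 a * [:p:]" by (simp add: const2_def)
    then show ?thesis by (simp only: subst2_mult subst2_const2)
  qed
  moreover have "subst2 [:p:] X2 (const2 (1 / a) * X1) = subst2 [:p:] X2 X1"
    by (rule subst2_const_poly_cong)
  ultimately show ?thesis
    by (simp add: aff_def shear_def comp2_Pair subst2_simps subst2_subst2 distrib_left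
        flip: mult.assoc)
qed

text \<open>The perturbations of order \<open>d\<close> cancel in the commutator
  \<open>\<kappa>\<close>, which moves its order above \<open>d\<close>; then
  \<open>exists_monomial_shear\<close> applies to it.\<close>

lemma increase_monomial_shear:
  fixes c :: "'a::field_char_0"
  assumes H: "subgroup H GA2" "closedin GA2_topology H" "Aff2 \<subseteq> H"
    and d: "d \<ge> 2" and c: "c \<noteq> 0" "shear (monom c d) \<in> H"
  shows "\<exists>e b. d < e \<and> b \<noteq> 0 \<and> shear (monom b e) \<in> H"
proof -
  define s :: "'a \<Rightarrow> 'a end2" where "s b = (X1 + const2 b * X2 ^ d, X2)" for b
  define r :: "'a \<Rightarrow> 'a end2" where "r b = (X1, X2 + const2 b * X1 ^ d)" for b
  have "shear (monom b d) \<in> H" for b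
    using scale_shear[OF H(1,3) c(2), of "b / c"] c(1) by (simp add: smult_monom)
  moreover have "(X2, X1) \<in> H" using H(3) swap_mem_Aff2 by blast
  ultimately have "comp2 (X2, X1) (comp2 (shear (monom b d)) (X2, X1)) \<in> H" "shear (monom b d) \<in> H" for b
    using H(1) by (auto intro!: subgroup_GA2_comp2)
  then have sr: "s b \<in> H" "r b \<in> H" for b
    unfolding swap_shear_monom by (simp_all add: s_def r_def shear_def subst2_const_poly_monom)
  define \<kappa> where "\<kappa> = comp2 (comp2 (s 1) (r 1)) (comp2 (s (- 1)) (r (- 1)))"
  have "\<kappa> \<in> H"
    unfolding \<kappa>_def using H(1) sr by (intro subgroup_GA2_comp2)
  have ord: "ord_ge d (const2 b * X1 ^ d)" "ord_ge d (const2 b * X2 ^ d)" for b :: 'a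
    by (intro ord_ge_const2_mult ord_ge_power ord_ge_X1 ord_ge_X2)+
  have near: "near_id d (const2 b * X2 ^ d) 0 (s b)" "near_id d 0 (const2 b * X1 ^ d) (r b)" for b :: 'a
    using near_id_add[of d "const2 b * X2 ^ d" 0] near_id_add[of d 0 "const2 b * X1 ^ d"]
    by (simp_all add: s_def r_def)
  have near2: "near_id d (const2 b * X2 ^ d) (const2 b * X1 ^ d) (comp2 (s b) (r b))" for b :: 'a
    using near_id_comp2[OF d near, of b b] ord by simp
  have "near_id d 0 0 \<kappa>"
    using near_id_comp2[OF d near2[of 1] near2[of "- 1"] ord(2)[of 1] ord(1)[of 1]
        ord(2)[of "- 1"] ord(1)[of "- 1"]]
    by (simp add: \<kappa>_def const2_minus)
  then have "ord_ge (Suc d) (fst \<kappa> - X1)" "ord_ge (Suc d) (snd \<kappa> - X2)"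
    by (simp_all add: near_id_def)
  \<comment> \<open>Otherwise \<open>s 1\<close> and \<open>r 1\<close> would commute; comparing
    first components and setting \<open>X2\<close> to 0 gives a contradiction.\<close>
  moreover have "\<kappa> \<noteq> (X1, X2)"
  proof
    assume \<kappa>: "\<kappa> = (X1, X2)"
    have "comp2 (comp2 (s (- 1)) (r (- 1))) (comp2 (r 1) (s 1)) = (X1, X2)"
      by (simp add: s_def r_def comp2_Pair subst2_simps const2_minus)
    then have "comp2 (s 1) (r 1) = comp2 \<kappa> (comp2 (r 1) (s 1))"
      by (simp add: \<kappa>_def comp2_assoc)
    then have "fst (comp2 (s 1) (r 1)) = fst (comp2 (r 1) (s 1))"
      by (simp add: \<kappa>)
    then have "(X2 + X1 ^ d) ^ d = (X2 ^ d :: 'a poly2)"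
      by (simp add: s_def r_def comp2_Pair subst2_simps)
    then have "subst2 ((X2 + X1 ^ d) ^ d) X1 0 = subst2 (X2 ^ d :: 'a poly2) X1 0"
      by simp
    then have "(X1 ^ d) ^ d = (0 :: 'a poly2)"
      using d by (simp add: subst2_simps)
    then show False by (simp add: X1_def)
  qed
  ultimately have "\<exists>e b. Suc d \<le> e \<and> b \<noteq> 0 \<and> shear (monom b e) \<in> H"
    using exists_monomial_shear[OF H \<open>\<kappa> \<in> H\<close>, of "Suc d"] d by simp
  then show ?thesis by (simp add: Suc_le_eq)
qed

section \<open>From monomial shears of unbounded degree to all shears\<close>

lemma degree_translate_diff:
  fixes p :: "'a::field_char_0 poly"
  assumes "degree p = Suc n"
  shows "degree (p \<circ>\<^sub>p [:1, 1:] - p) = n \<and> p \<circ>\<^sub>p [:1, 1:] - p \<noteq> 0"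
proof -
  define q where "q = p \<circ>\<^sub>p [:1, 1:] - p"
  have "p \<circ>\<^sub>p [:1, 1:] = (\<Sum>i\<le>degree p. smult (coeff p i) ([:1, 1:] ^ i))"
    unfolding pcompose_altdef poly_altdef by (simp add: degree_map_poly coeff_map_poly)
  moreover have "coeff ([:1, 1:] ^ i) k = (of_nat (i choose k) :: 'a)" for i k
  proof (cases "k \<le> i")
    case True
    then show ?thesis by (simp add: coeff_linear_poly_power)
  next
    case False
    then show ?thesis using degree_linear_power[of "1 :: 'a" i] by (simp add: coeff_eq_0 binomial_eq_0)
  qed
  ultimately have "coeff (p \<circ>\<^sub>p [:1, 1:]) k = (\<Sum>i\<le>Suc n. coeff p i * of_nat (i choose k))" for k
    by (simp only: assms coeff_sum coeff_smult)
  then have q: "coeff q k = (\<Sum>i\<le>Suc n. coeff p i * of_nat (i choose k)) - coeff p k" for k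
    by (simp add: q_def)
  have low: "(\<Sum>i\<le>n. coeff p i * of_nat (i choose k)) = (if k = n then coeff p n else 0)" if "n \<le> k" for k
    using that by (cases n) (auto simp: binomial_eq_0 intro!: sum.neutral)
  have "coeff q k = 0" if "n < k" for k
  proof (cases "k = Suc n")
    case True
    then show ?thesis using low[of k] by (simp add: q)
  next
    case False
    then show ?thesis using that assms low[of k] by (simp add: q binomial_eq_0 coeff_eq_0)
  qed
  then have "degree q \<le> n" by (intro degree_le) auto
  have "coeff p (Suc n) \<noteq> 0" using assms leading_coeff_0_iff[of p] by auto
  \<comment> \<open>This coefficient is \<open>n + 1\<close> times the leading coefficient of
    \<open>p\<close>, nonzero in characteristic zero.\<close>
  then have "coeff q n \<noteq> 0" using low[of n] by (simp add: q del: of_nat_Suc)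
  then have "n \<le> degree q" "q \<noteq> 0" using le_degree by auto
  with \<open>degree q \<le> n\<close> show ?thesis by (simp add: q_def)
qed

text \<open>Conjugation by the translation of \<open>X2\<close> by 1.\<close>

lemma translate_shear:
  fixes p :: "'a::field poly"
  assumes H: "subgroup H GA2" "Aff2 \<subseteq> H" and "shear p \<in> H"
  shows "shear (p \<circ>\<^sub>p [:1, 1:]) \<in> H"
proof -
  have "aff 1 0 0 0 1 1 \<in> H" "aff 1 0 0 0 1 (- 1) \<in> H"
    by (auto intro!: subsetD[OF H(2)] aff_mem_Aff2)
  then have "comp2 (aff 1 0 0 0 1 (- 1)) (comp2 (shear p) (aff 1 0 0 0 1 1)) \<in> H"
    using H assms(3) by (intro subgroup_GA2_comp2)
  moreover have "subst2 [:p \<circ>\<^sub>p [:1, 1:]:] X2 X1 = subst2 [:p:] (X2 + 1) X1"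
  proof (induction p)
    case (pCons a p)
    have step: "[:pCons a r:] = const2 a + X1 * [:r:]" for a and r :: "'a poly"
      by (simp add: const2_def X1_def)
    have "[:pCons a p \<circ>\<^sub>p [:1, 1:]:] = const2 a + (X1 + 1) * [:p \<circ>\<^sub>p [:1, 1:]:]"
      by (simp add: pcompose_pCons const2_def X1_def one_pCons)
    then show ?case
      by (simp only: step subst2_simps subst2_const2 subst2_X1 subst2_1 pCons.IH)
  qed simp
  moreover have "subst2 [:p:] (X2 + 1) X1 = subst2 [:p:] (X2 + 1) v" for v
    by (rule subst2_const_poly_cong)
  ultimately show ?thesis
    by (simp add: aff_def shear_def comp2_Pair subst2_simps subst2_subst2 const2_minus)
qed

text \<open>Differences with translates lower the degree by exactly one, so unbounded degrees yield
  a shear in \<open>H\<close> for a polynomial of every degree. Successive cancellation of leading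
  terms then reaches any \<open>p\<close>.\<close>

lemma all_shears:
  fixes p :: "'a::field_char_0 poly"
  assumes H: "subgroup H GA2" "Aff2 \<subseteq> H"
    and unbounded: "\<And>n. \<exists>d c. n \<le> d \<and> c \<noteq> 0 \<and> shear (monom c d) \<in> H"
  shows "shear p \<in> H"
proof -
  have add: "shear (p + q) \<in> H" if "shear p \<in> H" "shear q \<in> H" for p q
    using subgroup_GA2_comp2[OF H(1) that] by (simp add: shear_add)
  note smult = scale_shear[OF H]
  have diff: "shear (p - q) \<in> H" if "shear p \<in> H" "shear q \<in> H" for p q
    using add[OF that(1) smult[OF that(2), of "- 1"]] by simp
  have of_degree: "\<exists>q. shear q \<in> H \<and> q \<noteq> 0 \<and> degree q = n" for n
  proof -
    obtain d c where "n \<le> d" "c \<noteq> 0" "shear (monom c d) \<in> H" using unbounded by blast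
    then have "\<exists>q. shear q \<in> H \<and> q \<noteq> 0 \<and> degree q = d"
      by (intro exI[of _ "monom c d"]) (simp add: degree_monom_eq)
    with \<open>n \<le> d\<close> show ?thesis
    proof (induction rule: inc_induct)
      case (step k)
      then obtain q where "shear q \<in> H" "degree q = Suc k" by blast
      then show ?case
        using degree_translate_diff[of q k] diff[OF translate_shear[OF H]] by blast
    qed
  qed
  have "shear p \<in> H" if "\<And>i. n \<le> i \<Longrightarrow> coeff p i = 0" for n p
    using that
  proof (induction n arbitrary: p)
    case 0
    then have "p = 0" by (intro poly_eqI) simp
    then show ?case using subgroup.one_closed[OF H(1)] by (simp add: shear_0 one_GA2)
  next
    case (Suc n)
    obtain q where q: "shear q \<in> H" "q \<noteq> 0" "degree q = n" using of_degree by blast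
    define r where "r = smult (coeff p n / coeff q n) q"
    have "coeff q n \<noteq> 0" using q(2,3) by auto
    have "coeff (p - r) i = 0" if "n \<le> i" for i
    proof (cases "i = n")
      case True
      then show ?thesis using \<open>coeff q n \<noteq> 0\<close> by (simp add: r_def)
    next
      case False
      then show ?thesis using Suc(2)[of i] that q(3) by (simp add: r_def coeff_eq_0)
    qed
    then have "shear (p - r) \<in> H" by (rule Suc.IH)
    moreover have "shear r \<in> H" unfolding r_def by (rule smult[OF q(1)])
    ultimately show ?case using add[of "p - r" r] by simp
  qed
  from this[of "Suc (degree p)"] show ?thesis by (simp add: coeff_eq_0)
qed

text \<open>Compose a non-affine element with the inverse of its affine part at the origin. That
  part is invertible, as its determinant is the constant Jacobian.\<close>

lemma exists_tangent_to_id: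
  fixes H :: "'a::field_char_0 end2 set"
  assumes H: "subgroup H GA2" "Aff2 \<subset> H"
  obtains \<tau> where "\<tau> \<in> H" "\<tau> \<noteq> (X1, X2)" "ord_ge 2 (fst \<tau> - X1)" "ord_ge 2 (snd \<tau> - X2)"
proof -
  obtain \<sigma> where \<sigma>: "\<sigma> \<in> H" "\<sigma> \<notin> Aff2" using H(2) by blast
  have "\<sigma> \<in> carrier GA2" using subgroup.mem_carrier[OF H(1) \<sigma>(1)] .
  then obtain k where k: "k \<noteq> 0" "jac (fst \<sigma>) (snd \<sigma>) = const2 k" by (rule jac_GA2)
  define a b e c d f where lin: "a = coeff2 (fst \<sigma>) 1 0" "b = coeff2 (fst \<sigma>) 0 1"
    "e = coeff2 (fst \<sigma>) 0 0" "c = coeff2 (snd \<sigma>) 1 0" "d = coeff2 (snd \<sigma>) 0 1"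
    "f = coeff2 (snd \<sigma>) 0 0"
  have "coeff2 (jac (fst \<sigma>) (snd \<sigma>)) 0 0 = a * d - b * c"
  proof -
    have "coeff2 (p * q) 0 0 = coeff2 p 0 0 * coeff2 q 0 0" for p q :: "'a poly2"
      by (simp add: coeff2_def coeff_mult_0)
    then show ?thesis
      by (simp add: jac_def coeff2_diff coeff2_dx coeff2_dy lin)
  qed
  then have det: "a * d - b * c \<noteq> 0" using k by (simp add: coeff2_const2)
  define A where "A = aff a b e c d f"
  obtain a' b' e' c' d' f' where inv: "comp2 (aff a' b' e' c' d' f') A = (X1, X2)"
    "comp2 A (aff a' b' e' c' d' f') = (X1, X2)"
    unfolding A_def using aff_inverse[OF det] by metis
  have "A \<in> Aff2" unfolding A_def using det by (rule aff_mem_Aff2)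
  define \<tau> where "\<tau> = comp2 (aff a' b' e' c' d' f') \<sigma>"
  have "aff a' b' e' c' d' f' \<in> Aff2"
    using subgroup_GA2_inverse[OF subgroup_Aff2 \<open>A \<in> Aff2\<close> inv(1)] .
  then have "\<tau> \<in> H"
    unfolding \<tau>_def using H \<sigma>(1) by (intro subgroup_GA2_comp2) auto
  moreover have "\<tau> \<noteq> (X1, X2)"
  proof
    assume "\<tau> = (X1, X2)"
    then have "comp2 A (comp2 (aff a' b' e' c' d' f') \<sigma>) = A" by (simp add: \<tau>_def)
    then have "\<sigma> = A" by (simp add: inv flip: comp2_assoc)
    then show False using \<open>A \<in> Aff2\<close> \<sigma>(2) by simp
  qed
  moreover have ord: "ord_ge 2 (fst \<sigma> - fst A)" "ord_ge 2 (snd \<sigma> - snd A)"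
  proof -
    have small: "i = 0 \<and> j = 0 \<or> i = 1 \<and> j = 0 \<or> i = 0 \<and> j = 1" if "i + j < 2" for i j :: nat
      using that by arith
    show "ord_ge 2 (fst \<sigma> - fst A)" "ord_ge 2 (snd \<sigma> - snd A)"
      unfolding ord_ge_def A_def aff_def fst_conv snd_conv coeff2_diff coeff2_const2_X1_X2
      by (intro allI impI; drule small; elim disjE conjE; simp add: lin)+
  qed
  have "subst2 p (fst \<sigma>) (snd \<sigma>) - subst2 p (fst A) (snd A)
      = const2 x * (fst \<sigma> - fst A) + const2 y * (snd \<sigma> - snd A)"
    if "p = const2 x * X1 + const2 y * X2 + const2 z" for p x y z
    by (simp add: that subst2_simps algebra_simps)
  then have "fst \<tau> - fst (comp2 (aff a' b' e' c' d' f') A)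
      = const2 a' * (fst \<sigma> - fst A) + const2 b' * (snd \<sigma> - snd A)"
    "snd \<tau> - snd (comp2 (aff a' b' e' c' d' f') A)
      = const2 c' * (fst \<sigma> - fst A) + const2 d' * (snd \<sigma> - snd A)"
    unfolding \<tau>_def comp2_def aff_def fst_conv snd_conv by blast+
  then have "ord_ge 2 (fst \<tau> - X1)" "ord_ge 2 (snd \<tau> - X2)"
    unfolding inv fst_conv snd_conv using ord by (simp_all add: ord_ge_add ord_ge_const2_mult)
  ultimately show ?thesis using that by blast
qed

lemma closed_overgroup_shears:
  fixes H :: "'a::field_char_0 end2 set"
  assumes H: "subgroup H GA2" "closedin GA2_topology H" "Aff2 \<subset> H"
  shows "shear p \<in> H"
proof -
  have Aff: "Aff2 \<subseteq> H" using H(3) by blast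
  obtain \<tau> where \<tau>: "\<tau> \<in> H" "\<tau> \<noteq> (X1, X2)" "ord_ge 2 (fst \<tau> - X1)" "ord_ge 2 (snd \<tau> - X2)"
    using exists_tangent_to_id[OF H(1,3)] .
  \<comment> \<open>The bound 2 is carried along because \<open>increase_monomial_shear\<close>
    requires it at every step.\<close>
  have "\<exists>d c. max 2 n \<le> d \<and> c \<noteq> 0 \<and> shear (monom c d) \<in> H" for n
  proof (induction n)
    case 0
    then show ?case
      using exists_monomial_shear[OF H(1,2) Aff \<tau>(1) order_refl \<tau>(3,4,2)] by simp
  next
    case (Suc n)
    then obtain d c where dc: "max 2 n \<le> d" "c \<noteq> 0" "shear (monom c d) \<in> H" by blast
    then obtain e b where "d < e" "b \<noteq> 0" "shear (monom b e) \<in> H"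
      using increase_monomial_shear[OF H(1,2) Aff, of d c] by auto
    then show ?case using dc(1) by (intro exI[of _ e] exI[of _ b] conjI max.boundedI) auto
  qed
  then have "\<exists>d c. n \<le> d \<and> c \<noteq> 0 \<and> shear (monom c d) \<in> H" for n
    by (meson max.boundedE)
  then show ?thesis by (rule all_shears[OF H(1) Aff])
qed

lemma Aff2_neq_GA2: "Aff2 \<noteq> carrier (GA2 :: 'a::idom end2 monoid)"
proof
  assume "Aff2 = carrier (GA2 :: 'a end2 monoid)"
  then have "shear (monom 1 2) \<in> (Aff2 :: 'a end2 set)" using shear_mem_GA2 by blast
  then have "deg_end2 (shear (monom 1 2) :: 'a end2) \<le> 1"
    by (simp add: Aff2_eq_End2_le End2_le_def)
  then have "coeff2 (fst (shear (monom 1 2) :: 'a end2)) 0 2 = 0"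
    unfolding deg_end2_le_iff by simp
  moreover have "coeff2 (X2 ^ 2 :: 'a poly2) 0 2 = 1"
    using coeff2_mono2[of "1 :: 'a" 0 2 0 2] by (simp add: mono2_def)
  ultimately show False
    by (simp add: shear_def subst2_const_poly_monom coeff2_add coeff2_X1)
qed

theorem mainTheorem2:
  shows "subgroup (Aff2 :: 'a::{alg_closed_field, field_char_0} end2 set) GA2 \<and>
    closedin GA2_topology (Aff2 :: 'a end2 set) \<and>
    Aff2 \<noteq> carrier (GA2 :: 'a end2 monoid) \<and>
    (\<forall>H :: 'a end2 set.
       subgroup H GA2 \<and> closedin GA2_topology H \<and> Aff2 \<subset> H \<longrightarrow> H = carrier GA2)"
proof (intro conjI allI impI)
  fix H :: "'a end2 set"
  assume H: "subgroup H GA2 \<and> closedin GA2_topology H \<and> Aff2 \<subset> H"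
  then have "\<sigma> \<in> H" if "\<sigma> \<in> carrier GA2" for \<sigma>
    using jung_van_der_kulk[of H] closed_overgroup_shears[of H] that by blast
  moreover have "H \<subseteq> carrier GA2" using H by (auto dest: subgroup.subset)
  ultimately show "H = carrier GA2" by blast
qed (rule subgroup_Aff2 closedin_Aff2 Aff2_neq_GA2)+

end
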